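(* Let $K\subset\mathbb{R}^2$ be a compact convex set with boundary of class $\mathcal{C}^2$, having the origin as an interior point. For each integer $k\ge 2$ let $$f_k(\omega)=-2\sin\omega+\frac{k+1}{k-1}\sin((k-1)\omega)-\frac{k-1}{k+1}\sin((k+1)\omega).$$ Then $$\int_{P\notin K}f_k(\omega)\,dP=\int_{G_i\cap K\neq\emptyset}\bigl(1+(-1)^k(k^2-1)\cos(k(\varphi_2-\varphi_1))\bigr)\,dG_1\,dG_2.$$
   Context: For $P\notin K$, $\omega=\omega(P)\in(0,\pi)$ is the visual angle of $K$ from $P$, i.e. the angle between the two tangents from $P$ to the boundary of $K$ (the angle at $P$ of the sector with vertex $P$ containing $K$), and $dP$ is the area element of the plane. A line $G\subset\mathbb{R}^2$ not passing through the origin is given coordinates $(p,\varphi)$, $p>0$, $0\le\varphi<2\pi$, which are the polar coordinates of the point of $G$ at minimum distance from the origin (lines through the origin form a null set and are disregarded). $dG=dp\,d\varphi$, and ordered pairs of lines $(G_1,G_2)$, with coordinates $(p_i,\varphi_i)$, carry the measure $dG_1\,dG_2=dp_1\,d\varphi_1\,dp_2\,d\varphi_2$. The integral over $G_i\cap K\neq\emptyset$ is over all ordered pairs $(G_1,G_2)$ such that both $G_1$ and $G_2$ meet $K$. *)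

theory Defs
  imports "HOL-Analysis.Analysis"
begin

text \<open>This expresses regularity of class \<open>C\<^sup>2\<close> for the boundary of a compact convex set with
  interior points, because such a boundary is a single simple closed curve; \<open>L\<close> is the period
  of the parametrization.\<close>

definition C2_closed_curve :: "(real^2) set \<Rightarrow> bool" where
  "C2_closed_curve S \<longleftrightarrow>
     (\<exists>\<gamma> \<gamma>' \<gamma>'' L. L > 0 \<and>
        (\<forall>t::real. (\<gamma> has_vector_derivative \<gamma>' t) (at t)) \<and>
        (\<forall>t. (\<gamma>' has_vector_derivative \<gamma>'' t) (at t)) \<and>
        continuous_on UNIV \<gamma>'' \<and>
        (\<forall>t. \<gamma>' t \<noteq> 0) \<and>
        (\<forall>t. \<gamma> (t + L) = \<gamma> t) \<and>
        inj_on \<gamma> {0..<L} \<and>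
        \<gamma> ` {0..<L} = S)"

definition tangent_vector :: "(real^2) set \<Rightarrow> real^2 \<Rightarrow> real^2 \<Rightarrow> bool" where
  "tangent_vector S X u \<longleftrightarrow>
     (\<exists>c. (\<forall>t::real. c t \<in> S) \<and> c 0 = X \<and> (c has_vector_derivative u) (at 0))"

text \<open>\<open>u\<close> is the unit direction, seen from \<open>P\<close>, of a ray that is tangent to the boundary of \<open>K\<close>
  at one of its points.\<close>

definition tangent_from :: "(real^2) set \<Rightarrow> real^2 \<Rightarrow> real^2 \<Rightarrow> bool" where
  "tangent_from K P u \<longleftrightarrow>
     norm u = 1 \<and> (\<exists>r>0. tangent_vector (frontier K) (P + r *\<^sub>R u) u)"

definition sector :: "real^2 \<Rightarrow> real^2 \<Rightarrow> real^2 \<Rightarrow> (real^2) set" where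
  "sector P u v = {P + a *\<^sub>R u + b *\<^sub>R v | a b. a \<ge> 0 \<and> b \<ge> 0}"

text \<open>Meaningful only for \<open>P \<notin> K\<close>. Since \<open>K\<close> will have interior points, \<open>K \<subseteq> sector P u v\<close>
  forces \<open>u\<close> and \<open>v\<close> to be linearly independent, so they are the two distinct tangent
  directions and the angle of the sector is the angle between these two unit vectors.\<close>

definition visual_angle :: "(real^2) set \<Rightarrow> real^2 \<Rightarrow> real" where
  "visual_angle K P =
     (THE \<omega>. \<exists>u v. tangent_from K P u \<and> tangent_from K P v \<and> K \<subseteq> sector P u v \<and>
        \<omega> = arccos (u \<bullet> v))"

definition polar_point :: "real \<Rightarrow> real \<Rightarrow> real^2" where
  "polar_point p \<phi> = vector [p * cos \<phi>, p * sin \<phi>]"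

text \<open>For \<open>p > 0\<close>, the line through \<open>polar_point p \<phi>\<close> orthogonal to the position vector
  of that point.\<close>

definition polar_line :: "real \<times> real \<Rightarrow> (real^2) set" where
  "polar_line = (\<lambda>(p, \<phi>). {X. (X - polar_point p \<phi>) \<bullet> polar_point p \<phi> = 0})"

lemma closest_point_polar_line:
  assumes "p > 0"
  shows "closest_point (polar_line (p, \<phi>)) 0 = polar_point p \<phi>"
proof -
  let ?F = "polar_point p \<phi>"
  have eq: "polar_line (p, \<phi>) = {X. ?F \<bullet> X = ?F \<bullet> ?F}"
    unfolding polar_line_def prod.case inner_diff_left right_minus_eq
    by (subst inner_commute) (rule refl)
  have "?F = closest_point (polar_line (p, \<phi>)) 0"
  proof (rule closest_point_unique)
    show "convex (polar_line (p, \<phi>))" "closed (polar_line (p, \<phi>))"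
      unfolding eq by (rule convex_hyperplane, rule closed_hyperplane)
    show "?F \<in> polar_line (p, \<phi>)" by (simp add: eq)
    show "\<forall>z\<in>polar_line (p, \<phi>). dist 0 ?F \<le> dist 0 z"
    proof
      fix z assume "z \<in> polar_line (p, \<phi>)"
      then have "norm ?F * norm ?F \<le> norm ?F * norm z"
        using norm_cauchy_schwarz[of ?F z] by (simp add: eq dot_square_norm power2_eq_square)
      then show "dist 0 ?F \<le> dist 0 z"
        by (cases "?F = 0") auto
    qed
  qed
  then show ?thesis by simp
qed

definition line_coords :: "(real \<times> real) set" where
  "line_coords = {0<..} \<times> {0..<2 * pi}"

definition lines_meeting :: "(real^2) set \<Rightarrow> (real \<times> real) set" where
  "lines_meeting K = {G \<in> line_coords. polar_line G \<inter> K \<noteq> {}}"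

definition f :: "nat \<Rightarrow> real \<Rightarrow> real" where
  "f k \<omega> = - 2 * sin \<omega>
     + (real k + 1) / (real k - 1) * sin ((real k - 1) * \<omega>)
     - (real k - 1) / (real k + 1) * sin ((real k + 1) * \<omega>)"

end

theory Submission
  imports Defs "HOL-Probability.Sinc_Integral" "HOL-Library.Periodic_Fun"
begin

text \<open>
  Write \<open>u(\<phi>)\<close> for the unit vector with polar angle \<open>\<phi>\<close>. For a point \<open>P\<close> let \<open>S\<close> be the set of
  directions \<open>\<phi>\<close> with \<open>P \<bullet> u(\<phi>) > 0\<close>, and let \<open>A\<close> be the set of those for which the line through
  \<open>P\<close> with normal \<open>u(\<phi>)\<close> leaves \<open>K\<close> strictly on one side. The difference \<open>E = S - A\<close> consists of
  the normal angles of the lines through \<open>P\<close> that meet \<open>K\<close> and have \<open>p > 0\<close>. If \<open>P \<notin> K\<close>, then \<open>A\<close> is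
  an arc of length \<open>\<pi> - \<omega>(P)\<close> (\<open>visual_angle_arc\<close>; the regular boundary supplies the tangents by
  which \<open>\<omega>(P)\<close> is defined); if \<open>P \<in> K\<close>, then \<open>A\<close> is empty. Unless \<open>P = 0\<close>, \<open>S\<close> is a half circle.

  Let \<open>w(t) = 1 + (-1)\<^sup>k (k\<^sup>2 - 1) cos (k t)\<close>, so that \<open>w(\<phi>\<^sub>2 - \<phi>\<^sub>1)\<close> is the integrand for pairs of lines,
  and \<open>g(t) = \<bar>sin t\<bar> w(t)\<close>. As a function of \<open>\<alpha> = \<pi> - \<omega>\<close> the angle function \<open>f\<^sub>k\<close> vanishes at \<open>0\<close> and
  \<open>\<pi>\<close>, and its second derivative is \<open>2 g(\<alpha>)\<close> between them. With \<open>c\<close> for its slope at \<open>\<alpha> = 0\<close>,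
  it is therefore the energy of an arc of length \<open>\<alpha>\<close>: the double integral of \<open>g(\<psi> - \<phi>)\<close> over \<open>\<phi>, \<psi>\<close>
  in the arc, plus \<open>c \<alpha>\<close> (\<open>energy_arc\<close>). The energy of \<open>S\<close> is zero, so expanding the energy
  of \<open>A = S - E\<close> bilinearly (\<open>energy_diff\<close>) gives, for every \<open>P\<close>, that \<open>f\<^sub>k(\<omega>(P))\<close>, read as \<open>0\<close> for
  \<open>P \<in> K\<close>, is
  \<^item> the double integral of \<open>g(\<psi> - \<phi>)\<close> over \<open>\<phi>, \<psi> \<in> E\<close>,
  \<^item> minus the integral over \<open>\<phi> \<in> E\<close> of \<open>2 V(\<phi>) + c\<close>, where \<open>V(\<phi>)\<close> is the integral of \<open>g(\<psi> - \<phi>)\<close>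
    over \<open>\<psi> \<in> S\<close>.

  The theorem follows by integrating this identity over the plane. In the first term
  \<open>\<bar>sin (\<psi> - \<phi>)\<bar> dP d\<phi> d\<psi> = dG\<^sub>1 dG\<^sub>2\<close> for the two lines through \<open>P\<close> (\<open>distr_density_line_pairs\<close>), so
  it yields the integral over pairs of lines. The second term vanishes: for fixed \<open>\<phi>\<close>, in the
  coordinates \<open>x\<close> along \<open>u(\<phi>)\<close> and \<open>y\<close> orthogonal to it, \<open>2 V(\<phi>) + c\<close> depends only on \<open>y / x\<close>, decays
  like the inverse square of \<open>y / x\<close>, and has integral zero over the line of all \<open>y\<close> for every
  \<open>x > 0\<close> (\<open>integral_defect_arctan\<close>). Both terms are absolutely integrable, which also gives the
  integrability of the angle function outside \<open>K\<close>.
\<close>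

section \<open>Directions and area elements in the plane\<close>

definition dir :: "real \<Rightarrow> real^2" where
  "dir \<phi> = vector [cos \<phi>, sin \<phi>]"

lemma polar_point_dir: "polar_point p \<phi> = p *\<^sub>R dir \<phi>"
  by (simp add: polar_point_def dir_def vec_eq_iff forall_2)

lemma inner_dir: "P \<bullet> dir \<phi> = P$1 * cos \<phi> + P$2 * sin \<phi>"
  by (simp add: dir_def inner_vec_def sum_2)

lemma dir_inner_dir [simp]: "dir \<phi> \<bullet> dir \<psi> = cos (\<psi> - \<phi>)"
  unfolding inner_dir by (simp add: dir_def cos_diff)

lemma inner_dir_rotate:
  "P \<bullet> dir \<psi> = cos (\<psi> - \<phi>) * (P \<bullet> dir \<phi>) + sin (\<psi> - \<phi>) * (P \<bullet> dir (\<phi> + pi/2))"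
  using cos_add[of \<phi> "\<psi> - \<phi>"] sin_add[of \<phi> "\<psi> - \<phi>"]
  by (simp add: inner_dir cos_add sin_add) (simp add: algebra_simps)

lemma norm_dir [simp]: "norm (dir \<phi>) = 1"
  by (simp add: norm_eq_sqrt_inner)

lemma dir_periodic [simp]: "dir (t + 2 * pi) = dir t"
  by (simp add: dir_def)

lemma dir_polar: "\<exists>r \<theta>. 0 \<le> r \<and> P = r *\<^sub>R dir \<theta>"
proof -
  have "Complex (P$1) (P$2) = rcis (cmod (Complex (P$1) (P$2))) (Arg (Complex (P$1) (P$2)))"
    by (simp add: rcis_cmod_Arg)
  then have "P$1 = cmod (Complex (P$1) (P$2)) * cos (Arg (Complex (P$1) (P$2)))"
     "P$2 = cmod (Complex (P$1) (P$2)) * sin (Arg (Complex (P$1) (P$2)))"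
    by (metis Re_rcis complex.sel(1), metis Im_rcis complex.sel(2))
  then show ?thesis
    by (intro exI[of _ "cmod (Complex (P$1) (P$2))"] exI[of _ "Arg (Complex (P$1) (P$2))"])
      (simp add: dir_def vec_eq_iff forall_2)
qed

lemma unit_vector_dir:
  assumes "norm (u :: real^2) = 1" shows "\<exists>\<theta>. u = dir \<theta>"
proof -
  obtain r \<theta> where "0 \<le> r" "u = r *\<^sub>R dir \<theta>" using dir_polar[of u] by blast
  then show ?thesis using assms by auto
qed

lemma dir_axis: "dir \<phi> = cos \<phi> *\<^sub>R axis 1 1 + sin \<phi> *\<^sub>R axis 2 1"
  by (simp add: dir_def vec_eq_iff forall_2 axis_def)

lemma continuous_on_dir [continuous_intros]:
  fixes g :: "'a::t2_space \<Rightarrow> real"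
  shows "continuous_on A g \<Longrightarrow> continuous_on A (\<lambda>x. dir (g x))"
  unfolding dir_axis by (intro continuous_intros)

lemma measurable_dir [measurable]: "dir \<in> borel_measurable borel"
  by (rule borel_measurable_continuous_onI[OF continuous_on_dir[OF continuous_on_id]])

text \<open>Passing to coordinates along two orthogonal directions is a rotation followed by the
  identification of the vector type with the product type, and both preserve area.\<close>

lemma distr_inner_dir_orthogonal:
  "distr lborel borel (\<lambda>P. (P \<bullet> dir \<phi>, P \<bullet> dir (\<phi> + pi/2))) = (lborel :: (real \<times> real) measure)"
proof (rule lborel_eqI[symmetric])
  fix l u :: "real \<times> real"
  assume le: "\<And>b. b \<in> Basis \<Longrightarrow> l \<bullet> b \<le> u \<bullet> b"
  obtain l1 l2 u1 u2 where lu: "l = (l1, l2)" "u = (u1, u2)" by (metis prod.exhaust)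
  have le': "l1 \<le> u1" "l2 \<le> u2" using le[of "(1,0)"] le[of "(0,1)"] by (auto simp: lu Basis_prod_def)
  have box_lu: "box l u = {l1<..<u1} \<times> {l2<..<u2}"
    by (auto simp: lu box_def Basis_prod_def)
  define T :: "real^2 \<Rightarrow> real^2" where
    "T = (\<lambda>v. vector [v$1 * cos \<phi> - v$2 * sin \<phi>, v$1 * sin \<phi> + v$2 * cos \<phi>])"
  have lin: "linear T"
    by (rule linearI) (auto simp: T_def vec_eq_iff forall_2 algebra_simps)
  have "T v \<bullet> T w = v \<bullet> w" for v w
    using sin_cos_squared_add[of \<phi>]
    unfolding T_def inner_vec_def sum_2 vector_2 inner_real_def by algebra
  then have orth: "orthogonal_transformation T"
    using lin by (simp add: orthogonal_transformation_def)
  let ?B = "box (vector [l1, l2]) (vector [u1, u2]) :: (real^2) set"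
  let ?g = "\<lambda>P::real^2. (P \<bullet> dir \<phi>, P \<bullet> dir (\<phi> + pi/2))"
  have TB: "?g -` box l u = T ` ?B"
  proof (intro set_eqI iffI)
    fix P assume P: "P \<in> ?g -` box l u"
    define v :: "real^2" where "v = vector [P \<bullet> dir \<phi>, P \<bullet> dir (\<phi> + pi/2)]"
    have "cos \<phi> * (cos \<phi> * a) + sin \<phi> * (sin \<phi> * a) = a" for a
      using sin_cos_squared_add[of \<phi>] by algebra
    from this[of "P$1"] this[of "P$2"] have "T v = P"
      unfolding T_def v_def inner_dir
      by (simp add: vec_eq_iff forall_2 cos_add sin_add algebra_simps power2_eq_square)
    moreover have "v \<in> ?B" using P by (auto simp: box_lu v_def mem_box_cart forall_2)
    ultimately show "P \<in> T ` ?B" by blast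
  next
    fix P assume "P \<in> T ` ?B"
    then obtain v where v: "v \<in> ?B" "P = T v" by blast
    have "T v \<bullet> dir \<phi> = v$1" "T v \<bullet> dir (\<phi> + pi/2) = v$2"
      using sin_cos_squared_add[of \<phi>] unfolding T_def inner_dir cos_add sin_add vector_2
      by (simp_all, algebra+)
    then show "P \<in> ?g -` box l u" using v by (auto simp: box_lu mem_box_cart forall_2)
  qed
  have Bm: "?B \<in> lmeasurable" by simp
  have [measurable]: "?g \<in> borel \<rightarrow>\<^sub>M borel" by (auto simp: borel_prod[symmetric])
  have "emeasure (distr lborel borel ?g) (box l u) = emeasure lborel (?g -` box l u)"
    using emeasure_distr[of ?g lborel borel "box l u"] by simp
  also have "\<dots> = emeasure lebesgue (T ` ?B)"
  proof -
    have "?g -` box l u \<in> sets borel" using measurable_sets[of ?g borel borel "box l u"] by simp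
    then show ?thesis using TB by (simp add: emeasure_completion)
  qed
  also have "\<dots> = ennreal (measure lebesgue (T ` ?B))"
    using measurable_orthogonal_image[OF orth Bm] by (simp add: emeasure_eq_measure2)
  also have "measure lebesgue (T ` ?B) = measure lebesgue ?B"
    by (rule measure_orthogonal_image[OF orth Bm])
  also have "\<dots> = (u1 - l1) * (u2 - l2)"
  proof -
    have "measure lebesgue ?B = (\<Prod>b\<in>Basis. (vector [u1, u2] - vector [l1, l2] :: real^2) \<bullet> b)"
      using le' by (simp add: measure_completion measure_lborel_box_eq Basis_vec_def forall_2 inner_axis)
    also have "\<dots> = (u1 - l1) * (u2 - l2)"
      by (simp add: Basis_vec_def inner_axis prod.UNION_disjoint axis_eq_axis) (simp add: UNIV_2)
    finally show ?thesis .
  qed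
  also have "\<dots> = (\<Prod>b\<in>Basis. (u - l) \<bullet> b)"
    by (simp add: lu Basis_prod_def)
  finally show "emeasure (distr lborel borel ?g) (box l u) = ennreal (\<Prod>b\<in>Basis. (u - l) \<bullet> b)" .
qed simp

text \<open>The distances \<open>p, q\<close> of two lines through \<open>P\<close> with fixed normals are linear coordinates of
  \<open>P\<close> whose determinant is the sine of the angle between the normals. After the rotation to the
  first normal only a one-dimensional affine substitution remains.\<close>

lemma nn_integral_inner_dir_pair:
  fixes q :: "real \<times> real \<Rightarrow> ennreal"
  assumes [measurable]: "q \<in> borel_measurable borel" and nz: "sin (\<psi> - \<phi>) \<noteq> 0"
  shows "\<bar>sin (\<psi> - \<phi>)\<bar> * (\<integral>\<^sup>+P. q (P \<bullet> dir \<phi>, P \<bullet> dir \<psi>) \<partial>lborel) = (\<integral>\<^sup>+x. \<integral>\<^sup>+y. q (x, y) \<partial>lborel \<partial>lborel)"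
proof -
  define c s where "c = cos (\<psi> - \<phi>)" and "s = sin (\<psi> - \<phi>)"
  have rot: "P \<bullet> dir \<psi> = c * (P \<bullet> dir \<phi>) + s * (P \<bullet> dir (\<phi> + pi/2))" for P
    unfolding c_def s_def by (rule inner_dir_rotate)
  have [measurable]: "q \<in> borel_measurable (borel \<Otimes>\<^sub>M borel)" by (simp add: borel_prod)
  have "(\<integral>\<^sup>+P. q (P \<bullet> dir \<phi>, P \<bullet> dir \<psi>) \<partial>lborel)
      = (\<integral>\<^sup>+z. q (fst z, c * fst z + s * snd z) \<partial>distr lborel borel (\<lambda>P. (P \<bullet> dir \<phi>, P \<bullet> dir (\<phi> + pi/2))))"
    by (subst nn_integral_distr) (simp_all add: rot borel_prod[symmetric])
  also have "\<dots> = (\<integral>\<^sup>+z. q (fst z, c * fst z + s * snd z) \<partial>(lborel \<Otimes>\<^sub>M lborel))"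
    by (simp add: distr_inner_dir_orthogonal lborel_prod)
  also have "\<dots> = (\<integral>\<^sup>+x. \<integral>\<^sup>+y. q (x, c * x + s * y) \<partial>lborel \<partial>lborel)"
    by (subst lborel.nn_integral_fst[symmetric]) simp_all
  also have "\<bar>s\<bar> * \<dots> = (\<integral>\<^sup>+x. \<bar>s\<bar> * (\<integral>\<^sup>+y. q (x, c * x + s * y) \<partial>lborel) \<partial>lborel)"
    by (rule nn_integral_cmult[symmetric]) simp
  also have "\<dots> = (\<integral>\<^sup>+x. \<integral>\<^sup>+y. q (x, y) \<partial>lborel \<partial>lborel)"
    using nz by (intro nn_integral_cong nn_integral_real_affine[symmetric]) (simp_all add: s_def)
  finally show ?thesis by (simp add: s_def)
qed

lemma AE_sin_diff_nonzero: "AE \<psi> in lborel. sin (\<psi> - \<phi>) \<noteq> (0::real)"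
proof -
  have "{\<psi>. sin (\<psi> - \<phi>) = 0} \<subseteq> (\<lambda>i::int. \<phi> + of_int i * pi) ` UNIV"
    by (auto simp: sin_zero_iff_int2 image_iff) (metis add.commute diff_eq_eq)
  then have "countable {\<psi>. sin (\<psi> - \<phi>) = 0}"
    by (rule countable_subset) simp
  then show ?thesis
    by (intro AE_I'[OF countable_imp_null_set_lborel]) auto
qed

text \<open>The classical density formula \<open>dG\<^sub>1 dG\<^sub>2 = \<bar>sin (\<phi>\<^sub>2 - \<phi>\<^sub>1)\<bar> d\<phi>\<^sub>1 d\<phi>\<^sub>2 dP\<close> for two lines meeting at
  \<open>P\<close>. Stating it as an equality of measures transports integrability as well as integrals.
  Parallel normals form a null set.\<close>

lemma distr_density_line_pairs:
  "distr (density lborel (\<lambda>z. ennreal \<bar>sin (snd (snd z) - fst (snd z))\<bar>)) borel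
      (\<lambda>z. ((fst z \<bullet> dir (fst (snd z)), fst (snd z)), (fst z \<bullet> dir (snd (snd z)), snd (snd z))))
    = (lborel :: ((real \<times> real) \<times> (real \<times> real)) measure)"
  (is "distr (density _ ?w) _ ?g = _")
proof (rule measure_eqI)
  fix A :: "((real \<times> real) \<times> (real \<times> real)) set"
  assume "A \<in> sets (distr (density lborel ?w) borel ?g)"
  then have A: "A \<in> sets borel" by simp
  then have A'[measurable]: "A \<in> sets ((borel \<Otimes>\<^sub>M borel) \<Otimes>\<^sub>M (borel \<Otimes>\<^sub>M borel))" unfolding borel_prod .
  have [measurable]: "?g \<in> borel_measurable borel"
    unfolding borel_prod[symmetric] by measurable
  have [measurable]: "(\<lambda>z::(real^2) \<times> real \<times> real. \<bar>sin (snd (snd z) - fst (snd z))\<bar>) \<in> borel_measurable borel"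
    unfolding borel_prod[symmetric] by measurable
  let ?ind = "\<lambda>p. indicator A p :: ennreal"
  have [measurable]: "(\<lambda>z. ?ind (?g z)) \<in> borel_measurable borel"
    by (rule measurable_compose[of ?g borel borel]) (simp_all add: A borel_measurable_indicator)
  have "emeasure (distr (density lborel ?w) borel ?g) A = (\<integral>\<^sup>+z. ?ind z \<partial>(distr (density lborel ?w) borel ?g))"
    using A by simp
  also have "\<dots> = (\<integral>\<^sup>+z. ?w z * ?ind (?g z) \<partial>lborel)"
  proof -
    have "(\<integral>\<^sup>+z. ?ind z \<partial>(distr (density lborel ?w) borel ?g)) = (\<integral>\<^sup>+z. ?ind (?g z) \<partial>density lborel ?w)"
      using A by (intro nn_integral_distr) (simp_all add: borel_measurable_indicator)
    also have "\<dots> = (\<integral>\<^sup>+z. ?w z * ?ind (?g z) \<partial>lborel)"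
      by (intro nn_integral_density) simp_all
    finally show ?thesis .
  qed
  also have "\<dots> = (\<integral>\<^sup>+z. ?w z * ?ind (?g z) \<partial>(lborel \<Otimes>\<^sub>M (lborel \<Otimes>\<^sub>M lborel)))"
    by (simp add: lborel_prod)
  also have "\<dots> = (\<integral>\<^sup>+t. \<integral>\<^sup>+P. ?w (P, t) * ?ind (?g (P, t)) \<partial>lborel \<partial>(lborel \<Otimes>\<^sub>M lborel))"
    unfolding lborel_prod
    by (rule lborel_pair.nn_integral_snd[symmetric, unfolded lborel_prod]) simp
  also have "\<dots> = (\<integral>\<^sup>+\<phi>. \<integral>\<^sup>+\<psi>. \<integral>\<^sup>+P. ?w (P, (\<phi>, \<psi>)) * ?ind (?g (P, (\<phi>, \<psi>))) \<partial>lborel \<partial>lborel \<partial>lborel)"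
    by (subst lborel.nn_integral_fst[symmetric]) simp_all
  also have "\<dots> = (\<integral>\<^sup>+\<phi>. \<integral>\<^sup>+\<psi>. \<integral>\<^sup>+p. \<integral>\<^sup>+q. ?ind ((p, \<phi>), (q, \<psi>)) \<partial>lborel \<partial>lborel \<partial>lborel \<partial>lborel)"
  proof (rule nn_integral_cong, rule nn_integral_cong_AE, rule eventually_mono[OF AE_sin_diff_nonzero])
    fix \<phi> \<psi> :: real assume nz: "sin (\<psi> - \<phi>) \<noteq> 0"
    have [measurable]: "(\<lambda>(p, q). ?ind ((p, \<phi>), (q, \<psi>))) \<in> borel_measurable borel"
      by (simp add: borel_prod[symmetric])
    show "(\<integral>\<^sup>+P. ?w (P, (\<phi>, \<psi>)) * ?ind (?g (P, (\<phi>, \<psi>))) \<partial>lborel) =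
        (\<integral>\<^sup>+p. \<integral>\<^sup>+q. ?ind ((p, \<phi>), (q, \<psi>)) \<partial>lborel \<partial>lborel)"
      using nn_integral_inner_dir_pair[of "\<lambda>(p, q). ?ind ((p, \<phi>), (q, \<psi>))" \<psi> \<phi>, OF _ nz]
      by (simp add: nn_integral_cmult)
  qed
  also have "\<dots> = (\<integral>\<^sup>+\<phi>. \<integral>\<^sup>+p. \<integral>\<^sup>+\<psi>. \<integral>\<^sup>+q. ?ind ((p, \<phi>), (q, \<psi>)) \<partial>lborel \<partial>lborel \<partial>lborel \<partial>lborel)"
    by (intro nn_integral_cong lborel_pair.Fubini'[symmetric]) simp
  also have "\<dots> = (\<integral>\<^sup>+\<phi>. \<integral>\<^sup>+p. \<integral>\<^sup>+t. ?ind ((p, \<phi>), t) \<partial>(lborel \<Otimes>\<^sub>M lborel) \<partial>lborel \<partial>lborel)"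
    by (subst lborel_pair.nn_integral_snd[symmetric]) simp_all
  also have "\<dots> = (\<integral>\<^sup>+z. \<integral>\<^sup>+t. ?ind (z, t) \<partial>(lborel \<Otimes>\<^sub>M lborel) \<partial>(lborel \<Otimes>\<^sub>M lborel))"
  proof (rule lborel_pair.nn_integral_snd[where f = "\<lambda>z. \<integral>\<^sup>+t. ?ind (z, t) \<partial>(lborel \<Otimes>\<^sub>M lborel)"])
    show "(\<lambda>z. \<integral>\<^sup>+t. ?ind (z, t) \<partial>(lborel \<Otimes>\<^sub>M lborel)) \<in> borel_measurable (lborel \<Otimes>\<^sub>M lborel)"
      unfolding lborel_prod using A
      by (intro lborel.borel_measurable_nn_integral_fst) (simp add: lborel_prod borel_measurable_indicator)
  qed
  also have "\<dots> = (\<integral>\<^sup>+z. ?ind z \<partial>lborel)"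
    unfolding lborel_prod using A
    by (subst lborel.nn_integral_fst) (simp_all add: lborel_prod borel_measurable_indicator)
  also have "\<dots> = emeasure lborel A" using A by simp
  finally show "emeasure (distr (density lborel ?w) borel ?g) A = emeasure lborel A" .
qed simp

text \<open>The component along \<open>dir \<phi>\<close> is paired with \<open>\<phi>\<close>, so that the first two coordinates are those of
  the line through \<open>P\<close> with normal \<open>dir \<phi>\<close> and the last one is the position of \<open>P\<close> on that line.\<close>

lemma distr_rotated_coordinates:
  "distr lborel borel (\<lambda>z. ((fst z \<bullet> dir (snd z), snd z), fst z \<bullet> dir (snd z + pi/2)))
    = (lborel :: ((real \<times> real) \<times> real) measure)"
  (is "distr _ _ ?g = _")
proof (rule measure_eqI)
  fix A :: "((real \<times> real) \<times> real) set"
  assume "A \<in> sets (distr lborel borel ?g)"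
  then have A: "A \<in> sets borel" by simp
  then have A'[measurable]: "A \<in> sets ((borel \<Otimes>\<^sub>M borel) \<Otimes>\<^sub>M borel)" unfolding borel_prod .
  have [measurable]: "?g \<in> borel_measurable borel"
    unfolding borel_prod[symmetric] by measurable
  let ?ind = "\<lambda>p. indicator A p :: ennreal"
  have [measurable]: "(\<lambda>z. ?ind (?g z)) \<in> borel_measurable borel"
    by (rule measurable_compose[of ?g borel borel]) (simp_all add: A borel_measurable_indicator)
  have "emeasure (distr lborel borel ?g) A = (\<integral>\<^sup>+z. ?ind z \<partial>(distr lborel borel ?g))"
    using A by simp
  also have "\<dots> = (\<integral>\<^sup>+z. ?ind (?g z) \<partial>(lborel \<Otimes>\<^sub>M lborel))"
    using A by (subst nn_integral_distr) (simp_all add: lborel_prod)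
  also have "\<dots> = (\<integral>\<^sup>+\<phi>. \<integral>\<^sup>+P. ?ind (?g (P, \<phi>)) \<partial>lborel \<partial>lborel)"
    by (subst lborel_pair.nn_integral_snd[symmetric]) (simp_all add: borel_prod[symmetric])
  also have "\<dots> = (\<integral>\<^sup>+\<phi>. \<integral>\<^sup>+x. \<integral>\<^sup>+y. ?ind ((x, \<phi>), y) \<partial>lborel \<partial>lborel \<partial>lborel)"
  proof (rule nn_integral_cong)
    fix \<phi> :: real
    have [measurable]: "(\<lambda>(x, y). ?ind ((x, \<phi>), y)) \<in> borel_measurable borel"
      by (simp add: borel_prod[symmetric])
    show "(\<integral>\<^sup>+P. ?ind (?g (P, \<phi>)) \<partial>lborel) = (\<integral>\<^sup>+x. \<integral>\<^sup>+y. ?ind ((x, \<phi>), y) \<partial>lborel \<partial>lborel)"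
      using nn_integral_inner_dir_pair[of "\<lambda>(x, y). ?ind ((x, \<phi>), y)" "\<phi> + pi/2" \<phi>] by simp
  qed
  also have "\<dots> = (\<integral>\<^sup>+z. \<integral>\<^sup>+y. ?ind (z, y) \<partial>lborel \<partial>(lborel \<Otimes>\<^sub>M lborel))"
    by (rule lborel_pair.nn_integral_snd[where f = "\<lambda>z. \<integral>\<^sup>+y. ?ind (z, y) \<partial>lborel"]) simp
  also have "\<dots> = (\<integral>\<^sup>+z. ?ind z \<partial>lborel)"
    unfolding lborel_prod using A
    by (subst lborel.nn_integral_fst) (simp_all add: lborel_prod borel_measurable_indicator)
  also have "\<dots> = emeasure lborel A" using A by simp
  finally show "emeasure (distr lborel borel ?g) A = emeasure lborel A" .
qed simp

section \<open>Integrals of periodic functions over arcs\<close>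

lemma set_integrable_bounded_interval:
  fixes h :: "real \<Rightarrow> real"
  assumes [measurable]: "h \<in> borel_measurable borel" and b: "\<And>t. \<bar>h t\<bar> \<le> B"
  shows "set_integrable lborel {a..<b} h"
  unfolding set_integrable_def
proof (rule Bochner_Integration.integrable_bound)
  show "integrable lborel (\<lambda>t. B * indicator {a..<b} t)"
    by (cases "a \<le> b") (auto intro!: integrable_mult_right integrable_real_indicator)
  show "AE x in lborel. norm (indicat_real {a..<b} x *\<^sub>R h x) \<le> norm (B * indicat_real {a..<b} x)"
    using b by (intro AE_I2) (auto simp: indicator_def intro: order_trans[OF _ abs_ge_self])
qed simp

lemma set_integral_translate:
  fixes h :: "real \<Rightarrow> real"
  shows "(LINT t:{a..<b}|lborel. h (t + d)) = (LINT t:{a + d..<b + d}|lborel. h t)"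
  unfolding set_lebesgue_integral_def
  by (subst (2) lborel_integral_real_affine[where c = 1 and t = d])
     (auto intro!: Bochner_Integration.integral_cong simp: indicator_def add.commute)

lemma set_integral_period:
  fixes h :: "real \<Rightarrow> real"
  assumes T: "T > 0" and per: "\<And>t. h (t + T) = h t"
    and int: "\<And>a b. set_integrable lborel {a..<b} h"
  shows "(LINT t:{c..<c + T}|lborel. h t) = (LINT t:{0..<T}|lborel. h t)"
proof -
  interpret periodic_fun_simple h T by unfold_locales (rule per)
  define n where "n = \<lfloor>c / T\<rfloor>"
  define d where "d = c - of_int n * T"
  have d: "0 \<le> d" "d < T"
    using floor_divide_lower[OF T, of c] floor_divide_upper[OF T, of c]
    by (auto simp: d_def n_def algebra_simps)
  have c: "c = d + of_int n * T" by (simp add: d_def)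
  have "(LINT t:{c..<c + T}|lborel. h t) = (LINT t:{d..<d + T}|lborel. h (t + of_int n * T))"
    unfolding set_integral_translate by (simp add: c ac_simps)
  also have "\<dots> = (LINT t:{d..<T} \<union> {T..<d + T}|lborel. h t)"
    using d by (simp add: plus_of_int ivl_disj_un)
  also have "\<dots> = (LINT t:{d..<T}|lborel. h t) + (LINT t:{T..<d + T}|lborel. h t)"
    by (intro set_integral_Un int) auto
  also have "(LINT t:{T..<d + T}|lborel. h t) = (LINT t:{0..<d}|lborel. h t)"
    using set_integral_translate[of 0 d h T] by (simp add: per)
  also have "(LINT t:{d..<T}|lborel. h t) + (LINT t:{0..<d}|lborel. h t) = (LINT t:{0..<d} \<union> {d..<T}|lborel. h t)"
    by (subst set_integral_Un) (auto intro: int)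
  also have "{0..<d} \<union> {d..<T} = {0..<T}"
    using d by (auto)
  finally show ?thesis .
qed

text \<open>A set of directions that is an arc in the period starting at \<open>c\<close> may wrap around in the
  period starting at \<open>0\<close>; periodicity lets the integral be taken where it does not.\<close>

lemma set_integral_arc:
  fixes h :: "real \<Rightarrow> real"
  assumes per: "\<And>t. h (t + 2 * pi) = h t" "\<And>t. A (t + 2 * pi) = A t"
    and [measurable]: "h \<in> borel_measurable borel" "Measurable.pred borel A"
    and b: "\<And>t. \<bar>h t\<bar> \<le> B"
    and A: "\<And>t. t \<in> {c..<c + 2 * pi} \<Longrightarrow> A t \<longleftrightarrow> t \<in> {a<..<b}"
    and ab: "c \<le> a" "a \<le> b" "b \<le> c + 2 * pi"
  shows "(LINT t:{0..<2 * pi}|lborel. of_bool (A t) * h t) = (LINT t:{a..b}|lborel. h t)"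
proof -
  have "0 \<le> B" using b[of 0] by linarith
  then have "(LINT t:{0..<2 * pi}|lborel. of_bool (A t) * h t) = (LINT t:{c..<c + 2 * pi}|lborel. of_bool (A t) * h t)"
    by (intro set_integral_period[symmetric] set_integrable_bounded_interval[where B = B])
      (auto simp: per b of_bool_def)
  also have "\<dots> = (LINT t:{a..b}|lborel. h t)"
    unfolding set_lebesgue_integral_def
  proof (rule integral_cong_AE)
    have "AE t in lborel. t \<noteq> a \<and> t \<noteq> b"
      using AE_lborel_singleton[of a] AE_lborel_singleton[of b] by eventually_elim auto
    then show "AE t in lborel. indicat_real {c..<c + 2 * pi} t *\<^sub>R (of_bool (A t) * h t) = indicat_real {a..b} t *\<^sub>R h t"
    proof eventually_elim
      case (elim t)
      then show ?case using A[of t] ab by (cases "t \<in> {c..<c + 2 * pi}") (auto simp: indicator_def)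
    qed
  qed simp_all
  finally show ?thesis .
qed

section \<open>The visual angle as the complement of an arc of separating directions\<close>

lemma orthogonal_plane_parallel:
  fixes x y m :: "real^2"
  assumes "x \<bullet> m = 0" "y \<bullet> m = 0" "m \<noteq> 0" "x \<noteq> 0"
  shows "\<exists>a. y = a *\<^sub>R x"
proof -
  have m: "m$1 \<noteq> 0 \<or> m$2 \<noteq> 0" using assms by (auto simp: vec_eq_iff forall_2)
  have e: "x$1 * m$1 + x$2 * m$2 = 0" "y$1 * m$1 + y$2 * m$2 = 0"
    using assms by (auto simp: inner_vec_def sum_2)
  have d: "x$1 * y$2 = x$2 * y$1" using m
  proof
    assume "m$1 \<noteq> 0"
    moreover have "m$1 * (x$1 * y$2 - x$2 * y$1) = 0" using e by algebra
    ultimately show ?thesis by simp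
  next
    assume "m$2 \<noteq> 0"
    moreover have "m$2 * (x$1 * y$2 - x$2 * y$1) = 0" using e by algebra
    ultimately show ?thesis by simp
  qed
  have "x \<bullet> x \<noteq> 0" using assms by simp
  then have "y = ((x \<bullet> y) / (x \<bullet> x)) *\<^sub>R x"
    using d by (simp add: vec_eq_iff forall_2 inner_vec_def sum_2 field_simps)
  then show ?thesis by blast
qed

text \<open>At a boundary point where a linear functional is maximal, the derivative of the functional
  along the curve vanishes. In the plane the velocity is then parallel to \<open>u\<close>, so a linear
  reparametrization, possibly reversing the curve, has velocity \<open>u\<close>.\<close>

lemma C2_closed_curve_tangent:
  assumes S: "C2_closed_curve S" and X: "X \<in> S" and m: "m \<noteq> 0"
    and supp: "\<And>y. y \<in> S \<Longrightarrow> y \<bullet> m \<le> X \<bullet> m" and u: "u \<bullet> m = 0"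
  shows "tangent_vector S X u"
proof -
  obtain \<gamma> \<gamma>' :: "real \<Rightarrow> real^2" and L where L: "L > 0"
    and d: "\<And>t. (\<gamma> has_vector_derivative \<gamma>' t) (at t)" and nz: "\<And>t. \<gamma>' t \<noteq> 0"
    and per: "\<And>t. \<gamma> (t + L) = \<gamma> t" and img: "\<gamma> ` {0..<L} = S"
    using S unfolding C2_closed_curve_def by metis
  interpret periodic_fun_simple \<gamma> L by unfold_locales (rule per)
  have inS: "\<gamma> t \<in> S" for t
  proof -
    have "t - of_int \<lfloor>t / L\<rfloor> * L \<in> {0..<L}"
      using floor_divide_lower[OF L, of t] floor_divide_upper[OF L, of t] by (auto simp: algebra_simps)
    then have "\<gamma> (t - of_int \<lfloor>t / L\<rfloor> * L) \<in> S" using img by blast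
    then show ?thesis by (simp add: minus_of_int)
  qed
  obtain t0 where t0: "X = \<gamma> t0" using X img by auto
  have "((\<lambda>t. \<gamma> t \<bullet> m) has_field_derivative \<gamma>' t0 \<bullet> m) (at t0)"
    unfolding has_real_derivative_iff_has_vector_derivative
    by (rule bounded_linear.has_vector_derivative[OF bounded_linear_inner_left d])
  then have "\<gamma>' t0 \<bullet> m = 0"
    by (rule DERIV_local_max[where d = 1]) (auto simp: t0[symmetric] supp inS)
  then obtain a where a: "u = a *\<^sub>R \<gamma>' t0"
    using orthogonal_plane_parallel[OF _ u m nz] by blast
  have "((\<gamma> \<circ> (\<lambda>t. t0 + a * t)) has_vector_derivative a *\<^sub>R \<gamma>' t0) (at 0)"
    by (rule vector_diff_chain_at) (auto intro!: derivative_eq_intros d)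
  then show ?thesis
    unfolding tangent_vector_def using inS
    by (intro exI[of _ "\<gamma> \<circ> (\<lambda>t. t0 + a * t)"]) (simp add: t0 a)
qed

lemma maximum_in_frontier:
  fixes K :: "(real^2) set"
  assumes "closed K" "x \<in> K" "m \<noteq> 0" "\<And>y. y \<in> K \<Longrightarrow> y \<bullet> m \<le> x \<bullet> m"
  shows "x \<in> frontier K"
proof -
  have "x \<notin> interior K"
  proof
    assume "x \<in> interior K"
    then obtain e where e: "e > 0" "cball x e \<subseteq> K" by (auto simp: mem_interior_cball)
    let ?y = "x + (e / norm m) *\<^sub>R m"
    have "?y \<in> cball x e" using e assms(3) by (simp add: dist_norm)
    then have "?y \<bullet> m \<le> x \<bullet> m" using e assms(4) by blast
    then have "(e / norm m) * (m \<bullet> m) \<le> 0" by (simp add: inner_left_distrib)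
    moreover have "(e / norm m) * (m \<bullet> m) > 0" using e assms(3) by (intro mult_pos_pos divide_pos_pos) auto
    ultimately show False by simp
  qed
  then show ?thesis using assms(1,2) by (simp add: frontier_def closure_closed)
qed

text \<open>A ray from \<open>P\<close> through a point of \<open>K\<close> is tangent as soon as its line has \<open>K\<close> on one side.\<close>

lemma tangent_at_extremal_slope:
  fixes K :: "(real^2) set"
  assumes K: "compact K" and C2: "C2_closed_curve (frontier K)" and x: "x \<in> K" "x \<noteq> P"
    and m: "m \<noteq> 0" "(x - P) \<bullet> m = 0" "\<And>y. y \<in> K \<Longrightarrow> (y - P) \<bullet> m \<le> 0"
  shows "tangent_from K P ((1 / norm (x - P)) *\<^sub>R (x - P))"
proof -
  have le: "y \<bullet> m \<le> x \<bullet> m" if "y \<in> K" for y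
    using m(2) m(3)[OF that] by (simp add: inner_diff_left)
  have "x \<in> frontier K"
    using maximum_in_frontier[OF compact_imp_closed[OF K] x(1) m(1) le] .
  moreover have "frontier K \<subseteq> K" using compact_imp_closed[OF K] by (rule frontier_subset_closed)
  ultimately have "tangent_vector (frontier K) x ((1 / norm (x - P)) *\<^sub>R (x - P))"
    using m le by (intro C2_closed_curve_tangent[OF C2]) auto
  then show ?thesis
    unfolding tangent_from_def using x(2) by (auto intro!: exI[of _ "norm (x - P)"])
qed

text \<open>A line separating \<open>P\<close> from \<open>K\<close> makes the slope of \<open>x - P\<close> relative to its normal \<open>n\<close> a
  continuous function on \<open>K\<close>. The points of extremal slope span the two tangents, and every
  other slope is a convex combination of the extremal ones.\<close>

lemma ex_tangent_sector:
  fixes K :: "(real^2) set"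
  assumes K: "compact K" "convex K" "K \<noteq> {}" and C2: "C2_closed_curve (frontier K)" and P: "P \<notin> K"
  shows "\<exists>u v. tangent_from K P u \<and> tangent_from K P v \<and> K \<subseteq> sector P u v"
proof -
  obtain n b where nb: "n \<bullet> P < b" "\<And>x. x \<in> K \<Longrightarrow> n \<bullet> x > b"
    using separating_hyperplane_closed_point[OF K(2) compact_imp_closed[OF K(1)] P] by blast
  have N: "(x - P) \<bullet> n > 0" if "x \<in> K" for x
    using nb(1) nb(2)[OF that] by (simp add: inner_commute[of _ n] inner_diff_right)
  then have n: "n \<noteq> 0" using K(3) by force
  define w :: "real^2" where "w = vector [- n$2, n$1]"
  have wn: "w \<bullet> n = 0" "n \<bullet> w = 0" by (simp_all add: w_def inner_vec_def sum_2)
  have ww: "w \<bullet> w = n \<bullet> n" by (simp add: w_def inner_vec_def sum_2)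
  have w: "w \<noteq> 0" using n ww by auto
  define \<sigma> where "\<sigma> = (\<lambda>x. ((x - P) \<bullet> w) / ((x - P) \<bullet> n))"
  have s: "(x - P) \<bullet> w = \<sigma> x * ((x - P) \<bullet> n)" if "x \<in> K" for x
    using N[OF that] by (simp add: \<sigma>_def)
  have cont: "continuous_on K \<sigma>"
    unfolding \<sigma>_def using N by (intro continuous_intros) force
  obtain x1 where x1: "x1 \<in> K" "\<And>y. y \<in> K \<Longrightarrow> \<sigma> y \<le> \<sigma> x1"
    using continuous_attains_sup[OF K(1,3) cont] by blast
  obtain x2 where x2: "x2 \<in> K" "\<And>y. y \<in> K \<Longrightarrow> \<sigma> x2 \<le> \<sigma> y"
    using continuous_attains_inf[OF K(1,3) cont] by blast
  have ne: "x1 \<noteq> P" "x2 \<noteq> P" using x1 x2 P by auto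
  let ?u = "(1 / norm (x1 - P)) *\<^sub>R (x1 - P)" and ?v = "(1 / norm (x2 - P)) *\<^sub>R (x2 - P)"
  have "tangent_from K P ?u"
  proof (rule tangent_at_extremal_slope[OF K(1) C2 x1(1) ne(1)])
    have "(w - \<sigma> x1 *\<^sub>R n) \<bullet> w \<noteq> 0" using w wn by (simp add: inner_diff_left)
    then show "w - \<sigma> x1 *\<^sub>R n \<noteq> 0" by auto
    show "(x1 - P) \<bullet> (w - \<sigma> x1 *\<^sub>R n) = 0" by (simp only: inner_diff_right inner_scaleR_right s[OF x1(1)])
    show "(y - P) \<bullet> (w - \<sigma> x1 *\<^sub>R n) \<le> 0" if "y \<in> K" for y
      using mult_right_mono[OF x1(2)[OF that] less_imp_le[OF N[OF that]]]
      by (simp only: inner_diff_right inner_scaleR_right s[OF that])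
  qed
  moreover have "tangent_from K P ?v"
  proof (rule tangent_at_extremal_slope[OF K(1) C2 x2(1) ne(2)])
    have "(\<sigma> x2 *\<^sub>R n - w) \<bullet> w \<noteq> 0" using w wn by (simp add: inner_diff_left)
    then show "\<sigma> x2 *\<^sub>R n - w \<noteq> 0" by auto
    show "(x2 - P) \<bullet> (\<sigma> x2 *\<^sub>R n - w) = 0" by (simp only: inner_diff_right inner_scaleR_right s[OF x2(1)])
    show "(y - P) \<bullet> (\<sigma> x2 *\<^sub>R n - w) \<le> 0" if "y \<in> K" for y
      using mult_right_mono[OF x2(2)[OF that] less_imp_le[OF N[OF that]]]
      by (simp only: inner_diff_right inner_scaleR_right s[OF that])
  qed
  moreover have "K \<subseteq> sector P ?u ?v"
  proof
    fix x assume x: "x \<in> K"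
    \<comment> \<open>Position of the slope of \<open>x\<close> between the extremal slopes; the ratios of the components along
      \<open>n\<close> turn it into coefficients of \<open>x1 - P\<close> and \<open>x2 - P\<close>.\<close>
    obtain \<mu> where \<mu>: "0 \<le> \<mu>" "\<mu> \<le> 1" "\<sigma> x = \<mu> * \<sigma> x1 + (1 - \<mu>) * \<sigma> x2"
    proof (cases "\<sigma> x1 = \<sigma> x2")
      case True
      then show ?thesis using x1(2)[OF x] x2(2)[OF x] by (intro that[of 0]) auto
    next
      case False
      then have l: "\<sigma> x1 > \<sigma> x2" using x1(2)[OF x2(1)] by simp
      show ?thesis
      proof (rule that[of "(\<sigma> x - \<sigma> x2) / (\<sigma> x1 - \<sigma> x2)"])
        have "\<sigma> x - \<sigma> x2 = (\<sigma> x - \<sigma> x2) / (\<sigma> x1 - \<sigma> x2) * (\<sigma> x1 - \<sigma> x2)" using l by simp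
        then show "\<sigma> x = (\<sigma> x - \<sigma> x2) / (\<sigma> x1 - \<sigma> x2) * \<sigma> x1 + (1 - (\<sigma> x - \<sigma> x2) / (\<sigma> x1 - \<sigma> x2)) * \<sigma> x2"
          by algebra
      qed (use l x1(2)[OF x] x2(2)[OF x] in \<open>auto simp: field_simps\<close>)
    qed
    define N N1 N2 where "N = (x - P) \<bullet> n" and "N1 = (x1 - P) \<bullet> n" and "N2 = (x2 - P) \<bullet> n"
    have pos: "N > 0" "N1 > 0" "N2 > 0" using N x x1 x2 by (auto simp: N_def N1_def N2_def)
    define a b where "a = \<mu> * N / N1" and "b = (1 - \<mu>) * N / N2"
    have aN: "a * N1 = \<mu> * N" "b * N2 = (1 - \<mu>) * N" using pos by (simp_all add: a_def b_def)
    have ab: "a \<ge> 0" "b \<ge> 0" using \<mu> pos by (auto simp: a_def b_def)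
    define z where "z = (x - P) - (a *\<^sub>R (x1 - P) + b *\<^sub>R (x2 - P))"
    have zn: "z \<bullet> n = 0"
      unfolding z_def inner_diff_left[of _ "_ + _"] inner_add_left inner_scaleR_left N_def[symmetric] N1_def[symmetric] N2_def[symmetric]
      using aN by algebra
    have "z \<bullet> w = \<sigma> x * N - (a * (\<sigma> x1 * N1) + b * (\<sigma> x2 * N2))"
      unfolding z_def inner_diff_left[of _ "_ + _"] inner_add_left inner_scaleR_left s[OF x] s[OF x1(1)] s[OF x2(1)]
      by (simp add: N_def N1_def N2_def)
    also have "\<dots> = 0" using aN \<mu>(3) by algebra
    finally have zw: "z \<bullet> w = 0" .
    have "z = 0"
    proof (rule ccontr)
      assume "z \<noteq> 0"
      then obtain a where "w = a *\<^sub>R z"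
        using orthogonal_plane_parallel[OF zn wn(1) n] by blast
      then have "w \<bullet> w = 0" using zw by (metis inner_scaleR_left mult_zero_right)
      then show False using w by simp
    qed
    then have "x = P + (a * norm (x1 - P)) *\<^sub>R ?u + (b * norm (x2 - P)) *\<^sub>R ?v"
      using ne by (simp add: z_def algebra_simps)
    moreover have "a * norm (x1 - P) \<ge> 0" "b * norm (x2 - P) \<ge> 0" using ab by simp_all
    ultimately show "x \<in> sector P ?u ?v" unfolding sector_def by blast
  qed
  ultimately show ?thesis by blast
qed

text \<open>The cone of \<open>K\<close> seen from \<open>P\<close> is spanned by the two tangent directions, so a functional is
  negative on the cone exactly if it is negative on these two.\<close>

lemma sector_separating_directions:
  assumes P: "P \<notin> K" and r: "r > 0" "P + r *\<^sub>R u \<in> K" and s: "s > 0" "P + s *\<^sub>R v \<in> K"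
    and K: "K \<subseteq> sector P u v"
  shows "(\<forall>x\<in>K. x \<bullet> n < P \<bullet> n) \<longleftrightarrow> u \<bullet> n < 0 \<and> v \<bullet> n < 0"
proof
  assume L: "\<forall>x\<in>K. x \<bullet> n < P \<bullet> n"
  then have "r * (u \<bullet> n) < 0" "s * (v \<bullet> n) < 0"
    using r s by (force simp: inner_add_left)+
  then show "u \<bullet> n < 0 \<and> v \<bullet> n < 0" using r(1) s(1) by (simp add: mult_less_0_iff)
next
  assume R: "u \<bullet> n < 0 \<and> v \<bullet> n < 0"
  show "\<forall>x\<in>K. x \<bullet> n < P \<bullet> n"
  proof
    fix x assume x: "x \<in> K"
    then obtain a b where ab: "x = P + a *\<^sub>R u + b *\<^sub>R v" "a \<ge> 0" "b \<ge> 0"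
      using K unfolding sector_def by blast
    have "a \<noteq> 0 \<or> b \<noteq> 0" using ab x P by auto
    then have "a * (u \<bullet> n) + b * (v \<bullet> n) < 0"
    proof
      assume "a \<noteq> 0"
      then have "a * (u \<bullet> n) < 0" using ab R by (simp add: mult_less_0_iff)
      moreover have "b * (v \<bullet> n) \<le> 0" using ab R by (simp add: mult_nonneg_nonpos)
      ultimately show ?thesis by linarith
    next
      assume "b \<noteq> 0"
      then have "b * (v \<bullet> n) < 0" using ab R by (simp add: mult_less_0_iff)
      moreover have "a * (u \<bullet> n) \<le> 0" using ab R by (simp add: mult_nonneg_nonpos)
      ultimately show ?thesis by linarith
    qed
    then show "x \<bullet> n < P \<bullet> n" by (simp add: ab(1) inner_add_left)
  qed
qed

lemma cos_negative_arc:
  assumes "0 \<le> \<omega>" "\<omega> \<le> pi" "t \<in> {pi/2..<pi/2 + 2 * pi}"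
  shows "cos t < 0 \<and> cos (t - \<omega>) < 0 \<longleftrightarrow> t \<in> {pi/2 + \<omega><..<pi/2 + pi}"
proof -
  have neg: "cos s < 0 \<longleftrightarrow> pi/2 < s" if "- pi/2 \<le> s" "s < 3 * pi / 2" for s
  proof (cases "pi/2 < s")
    case True
    have "cos (s - pi) > 0" using True that by (intro cos_gt_zero_pi) auto
    then show ?thesis using True by (simp add: cos_diff)
  next
    case False
    then show ?thesis using cos_ge_zero[of s] that by auto
  qed
  show ?thesis
  proof (cases "t < 3 * pi / 2")
    case True
    then show ?thesis using neg[of t] neg[of "t - \<omega>"] assms by auto
  next
    case False
    have "cos (t - 2 * pi) \<ge> 0" using False assms by (intro cos_ge_zero) auto
    then show ?thesis using False by (simp add: cos_diff)
  qed
qed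

text \<open>The directions at an obtuse angle to one unit vector form an open half circle. Two half
  circles whose centres differ by \<open>\<omega> = arccos (u \<bullet> v)\<close> intersect in an arc of length \<open>\<pi> - \<omega>\<close>. Its
  position \<open>c\<close> is read off from the half circle of \<open>u\<close> or from that of \<open>v\<close>, according to the
  orientation of the pair.\<close>

lemma negative_directions_arc:
  assumes "norm u = 1" "norm v = 1"
  shows "\<exists>c. \<forall>t\<in>{c..<c + 2 * pi}. (u \<bullet> dir t < 0 \<and> v \<bullet> dir t < 0) \<longleftrightarrow> t \<in> {c + arccos (u \<bullet> v)<..<c + pi}"
proof -
  obtain \<theta> \<eta> where uv: "u = dir \<theta>" "v = dir \<eta>" using assms unit_vector_dir by metis
  define \<omega> where "\<omega> = arccos (u \<bullet> v)"
  have "\<bar>u \<bullet> v\<bar> \<le> 1" using Cauchy_Schwarz_ineq2[of u v] assms by simp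
  then have \<omega>: "0 \<le> \<omega>" "\<omega> \<le> pi" "cos \<omega> = u \<bullet> v"
    by (auto simp: \<omega>_def arccos_lbound arccos_ubound cos_arccos_abs)
  have "cos (\<eta> - \<theta>) = cos \<omega>" by (simp add: \<omega>(3) uv)
  then obtain n :: real where n: "n \<in> \<int>" "\<eta> - \<theta> = \<omega> + 2 * n * pi \<or> \<eta> - \<theta> = - \<omega> + 2 * n * pi"
    by (auto simp: cos_eq)
  have per: "cos (x + 2 * n * pi) = cos x" "cos (x - 2 * n * pi) = cos x" for x
    using cos_integer_2pi[OF n(1)] sin_integer_2pi[OF n(1)] by (simp_all add: cos_add cos_diff mult_ac)
  from n(2) show ?thesis
  proof
    assume e: "\<eta> - \<theta> = \<omega> + 2 * n * pi"
    show ?thesis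
    proof (intro exI[of _ "\<theta> + pi/2"] ballI)
      fix t assume t: "t \<in> {\<theta> + pi/2..<\<theta> + pi/2 + 2 * pi}"
      have "t - \<eta> = (t - \<theta> - \<omega>) - 2 * n * pi" using e by simp
      then have "cos (t - \<eta>) = cos (t - \<theta> - \<omega>)" using per by metis
      then show "(u \<bullet> dir t < 0 \<and> v \<bullet> dir t < 0) \<longleftrightarrow> t \<in> {\<theta> + pi/2 + arccos (u \<bullet> v)<..<\<theta> + pi/2 + pi}"
        using cos_negative_arc[OF \<omega>(1,2), of "t - \<theta>"] t unfolding uv dir_inner_dir \<omega>_def[symmetric, unfolded uv dir_inner_dir] by auto
    qed
  next
    assume e: "\<eta> - \<theta> = - \<omega> + 2 * n * pi"
    show ?thesis
    proof (intro exI[of _ "\<eta> + pi/2"] ballI)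
      fix t assume t: "t \<in> {\<eta> + pi/2..<\<eta> + pi/2 + 2 * pi}"
      have "t - \<theta> = (t - \<eta> - \<omega>) + 2 * n * pi" using e by simp
      then have "cos (t - \<theta>) = cos (t - \<eta> - \<omega>)" using per by metis
      then show "(u \<bullet> dir t < 0 \<and> v \<bullet> dir t < 0) \<longleftrightarrow> t \<in> {\<eta> + pi/2 + arccos (u \<bullet> v)<..<\<eta> + pi/2 + pi}"
        using cos_negative_arc[OF \<omega>(1,2), of "t - \<eta>"] t unfolding uv dir_inner_dir \<omega>_def[symmetric, unfolded uv dir_inner_dir] by auto
    qed
  qed
qed

text \<open>This recovers the angle from the set of directions alone and thereby makes the visual angle
  well defined.\<close>

lemma negative_directions_measure:
  assumes "norm u = 1" "norm v = 1"
  shows "(LINT t:{0..<2 * pi}|lborel. of_bool (u \<bullet> dir t < 0 \<and> v \<bullet> dir t < 0)) = pi - arccos (u \<bullet> v)"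
proof -
  obtain c where c: "\<And>t. t\<in>{c..<c + 2 * pi} \<Longrightarrow> (u \<bullet> dir t < 0 \<and> v \<bullet> dir t < 0) \<longleftrightarrow> t \<in> {c + arccos (u \<bullet> v)<..<c + pi}"
    using negative_directions_arc[OF assms] by blast
  have "\<bar>u \<bullet> v\<bar> \<le> 1" using Cauchy_Schwarz_ineq2[of u v] assms by simp
  then have \<omega>: "0 \<le> arccos (u \<bullet> v)" "arccos (u \<bullet> v) \<le> pi"
    by (auto simp: arccos_lbound arccos_ubound)
  have "(LINT t:{0..<2 * pi}|lborel. of_bool (u \<bullet> dir t < 0 \<and> v \<bullet> dir t < 0) * (1::real)) = (LINT t:{c + arccos (u \<bullet> v)..c + pi}|lborel. 1)"
    by (rule set_integral_arc[where B = 1 and c = c]) (use c \<omega> in auto)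
  then show ?thesis using \<omega> by (simp add: set_integral_const)
qed

text \<open>Every admissible pair of tangents has the same set of separating directions, hence the same
  angle; so the definite description denotes that angle.\<close>

lemma visual_angle_arc:
  fixes K :: "(real^2) set"
  assumes K: "compact K" "convex K" "K \<noteq> {}" and C2: "C2_closed_curve (frontier K)" and P: "P \<notin> K"
  shows "\<exists>u v c. (\<forall>n. (\<forall>x\<in>K. x \<bullet> n < P \<bullet> n) \<longleftrightarrow> u \<bullet> n < 0 \<and> v \<bullet> n < 0) \<and>
    0 \<le> visual_angle K P \<and> visual_angle K P \<le> pi \<and>
    (\<forall>t\<in>{c..<c + 2 * pi}. (u \<bullet> dir t < 0 \<and> v \<bullet> dir t < 0) \<longleftrightarrow> t \<in> {c + visual_angle K P<..<c + pi})"
proof -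
  let ?V = "\<lambda>u v. tangent_from K P u \<and> tangent_from K P v \<and> K \<subseteq> sector P u v"
  have sub: "frontier K \<subseteq> K" using compact_imp_closed[OF K(1)] by (rule frontier_subset_closed)
  have in_K: "norm u = 1 \<and> (\<exists>r>0. P + r *\<^sub>R u \<in> K)" if "tangent_from K P u" for u
    using that sub unfolding tangent_from_def tangent_vector_def by (metis subsetD)
  have sep: "(\<forall>x\<in>K. x \<bullet> n < P \<bullet> n) \<longleftrightarrow> u \<bullet> n < 0 \<and> v \<bullet> n < 0" if V: "?V u v" for u v n
  proof -
    obtain r s where "r > 0" "P + r *\<^sub>R u \<in> K" "s > 0" "P + s *\<^sub>R v \<in> K" using V in_K by blast
    then show ?thesis using V by (intro sector_separating_directions[OF P]) auto
  qed
  have val: "arccos (u \<bullet> v) = pi - (LINT t:{0..<2 * pi}|lborel. of_bool (\<forall>x\<in>K. x \<bullet> dir t < P \<bullet> dir t))"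
    if V: "?V u v" for u v
    using negative_directions_measure[of u v] V in_K unfolding sep[OF V] by auto
  obtain u v where V: "?V u v" using ex_tangent_sector[OF assms] by blast
  have va: "visual_angle K P = arccos (u \<bullet> v)"
    unfolding visual_angle_def
  proof (rule the_equality)
    show "\<exists>a b. tangent_from K P a \<and> tangent_from K P b \<and> K \<subseteq> sector P a b \<and> arccos (u \<bullet> v) = arccos (a \<bullet> b)"
      using V by blast
  next
    fix \<omega> assume "\<exists>a b. tangent_from K P a \<and> tangent_from K P b \<and> K \<subseteq> sector P a b \<and> \<omega> = arccos (a \<bullet> b)"
    then obtain a b where ab: "?V a b" "\<omega> = arccos (a \<bullet> b)" by blast
    show "\<omega> = arccos (u \<bullet> v)" using val[OF ab(1)] val[OF V] ab(2) by simp
  qed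
  have nuv: "norm u = 1" "norm v = 1" using V in_K by auto
  then have "\<bar>u \<bullet> v\<bar> \<le> 1" using Cauchy_Schwarz_ineq2[of u v] by simp
  then have \<omega>: "0 \<le> visual_angle K P" "visual_angle K P \<le> pi"
    by (auto simp: va arccos_lbound arccos_ubound)
  obtain c where c: "\<And>t. t\<in>{c..<c + 2 * pi} \<Longrightarrow> (u \<bullet> dir t < 0 \<and> v \<bullet> dir t < 0) \<longleftrightarrow> t \<in> {c + visual_angle K P<..<c + pi}"
    unfolding va using negative_directions_arc[OF nuv] by blast
  show ?thesis
    by (intro exI[of _ u] exI[of _ v] exI[of _ c] conjI allI ballI sep[OF V] \<omega> c)
qed

section \<open>A kernel whose double integral over an arc is the angle function\<close>

text \<open>The angle function \<open>f k\<close> in terms of the supplementary angle.\<close>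

definition arc_value :: "nat \<Rightarrow> real \<Rightarrow> real" where
  "arc_value k t = - 2 * sin t + (-1) ^ k *
     ((real k + 1) / (real k - 1) * sin ((real k - 1) * t) - (real k - 1) / (real k + 1) * sin ((real k + 1) * t))"

text \<open>The derivative of \<open>arc_value k\<close>.\<close>

definition arc_slope :: "nat \<Rightarrow> real \<Rightarrow> real" where
  "arc_slope k t = - 2 * cos t + (-1) ^ k * ((real k + 1) * cos ((real k - 1) * t) - (real k - 1) * cos ((real k + 1) * t))"

definition weight :: "nat \<Rightarrow> real \<Rightarrow> real" where
  "weight k t = 1 + (-1) ^ k * ((real k)\<^sup>2 - 1) * cos (real k * t)"

definition kernel :: "nat \<Rightarrow> real \<Rightarrow> real" where
  "kernel k t = \<bar>sin t\<bar> * weight k t"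

lemma f_eq_arc_value: "f k \<omega> = arc_value k (pi - \<omega>)"
proof -
  have c: "cos (real k * pi) = (-1) ^ k" "sin (real k * pi) = 0" by simp_all
  have "sin ((real k - 1) * \<omega>) = sin (real k * pi - (pi + (real k - 1) * (pi - \<omega>)))"
    by (simp add: algebra_simps)
  also have "\<dots> = (-1) ^ k * sin ((real k - 1) * (pi - \<omega>))"
    unfolding sin_diff[of "real k * pi"] c by simp
  finally have 1: "sin ((real k - 1) * \<omega>) = (-1) ^ k * sin ((real k - 1) * (pi - \<omega>))" .
  have "sin ((real k + 1) * \<omega>) = sin (real k * pi - ((real k + 1) * (pi - \<omega>) - pi))"
    by (simp add: algebra_simps)
  also have "\<dots> = (-1) ^ k * sin ((real k + 1) * (pi - \<omega>))"
    unfolding sin_diff[of "real k * pi"] c by (simp add: sin_diff)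
  finally have 2: "sin ((real k + 1) * \<omega>) = (-1) ^ k * sin ((real k + 1) * (pi - \<omega>))" .
  show ?thesis unfolding f_def arc_value_def 1 2 by (simp add: sin_diff algebra_simps)
qed

lemma arc_value_0 [simp]: "arc_value k 0 = 0"
  by (simp add: arc_value_def)

lemma arc_value_pi [simp]: "arc_value k pi = 0"
  using f_eq_arc_value[of k 0] by (simp add: f_def)

lemma DERIV_arc_value:
  assumes "k \<ge> 2" shows "(arc_value k has_real_derivative arc_slope k t) (at t)"
proof -
  have sin_scaled: "((\<lambda>t. a / b * sin (b * t)) has_real_derivative a * cos (b * t)) (at t)" if "b \<noteq> 0" for a b :: real
    using that by (auto intro!: derivative_eq_intros)
  have "real k - 1 \<noteq> 0" "real k + 1 \<noteq> 0" using assms by auto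
  then show ?thesis
    unfolding arc_value_def arc_slope_def
    by (auto intro!: derivative_eq_intros sin_scaled)
qed

lemma DERIV_arc_slope: "(arc_slope k has_real_derivative 2 * (sin t * weight k t)) (at t)"
proof -
  have e: "sin ((real k - 1) * t) = sin (real k * t) * cos t - cos (real k * t) * sin t"
    "sin ((real k + 1) * t) = sin (real k * t) * cos t + cos (real k * t) * sin t"
    using sin_diff[of "real k * t" t] sin_add[of "real k * t" t] by (simp_all add: algebra_simps)
  have "(arc_slope k has_real_derivative 2 * sin t + (-1) ^ k *
     (- (real k + 1) * ((real k - 1) * sin ((real k - 1) * t)) + (real k - 1) * ((real k + 1) * sin ((real k + 1) * t)))) (at t)"
    unfolding arc_slope_def by (auto intro!: derivative_eq_intros simp: algebra_simps)
  also have "2 * sin t + (-1) ^ k *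
     (- (real k + 1) * ((real k - 1) * sin ((real k - 1) * t)) + (real k - 1) * ((real k + 1) * sin ((real k + 1) * t)))
     = 2 * (sin t * weight k t)"
    unfolding e weight_def by (simp add: algebra_simps power2_eq_square)
  finally show ?thesis .
qed

lemma continuous_on_kernel [continuous_intros]:
  "continuous_on A h \<Longrightarrow> continuous_on A (\<lambda>x. kernel k (h x))" for h :: "'a::t2_space \<Rightarrow> real"
  unfolding kernel_def weight_def by (intro continuous_intros)

lemma kernel_periodic [simp]: "kernel k (t + 2 * pi) = kernel k t"
proof -
  have "cos (real k * (t + 2 * pi)) = cos (real k * t)"
    using sin_cos_eq_iff[of "real k * (t + 2 * pi)" "real k * t"]
    by (auto simp: algebra_simps intro!: exI[of _ "int k"])
  then show ?thesis by (simp add: kernel_def weight_def)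
qed

lemma kernel_even: "kernel k (- t) = kernel k t"
  by (simp add: kernel_def weight_def)

lemma abs_weight_le: "\<bar>weight k t\<bar> \<le> 2 + (real k)\<^sup>2"
proof -
  have "\<bar>((-1) ^ k * ((real k)\<^sup>2 - 1)) * cos (real k * t)\<bar> \<le> \<bar>(real k)\<^sup>2 - 1\<bar> * 1"
    unfolding abs_mult by (intro mult_mono) (auto simp: power_abs)
  also have "\<dots> \<le> (real k)\<^sup>2 + 1" by (auto simp: abs_le_iff)
  finally show ?thesis unfolding weight_def by linarith
qed

lemma abs_kernel_le: "\<bar>kernel k t\<bar> \<le> 2 + (real k)\<^sup>2"
proof -
  have "\<bar>kernel k t\<bar> \<le> 1 * (2 + (real k)\<^sup>2)"
    unfolding kernel_def abs_mult by (intro mult_mono abs_weight_le) auto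
  then show ?thesis by simp
qed

lemma measurable_kernel [measurable]: "kernel k \<in> borel_measurable borel"
  unfolding kernel_def weight_def by measurable

text \<open>On either side of \<open>x\<close> the sine has a constant sign, so that \<open>arc_slope k / 2\<close> is a primitive
  of the kernel up to sign.\<close>

lemma integral_kernel_point_arc:
  assumes "a \<le> x" "x \<le> b" "x - a \<le> pi" "b - x \<le> pi"
  shows "(LINT y:{a..b}|lborel. kernel k (y - x)) = (arc_slope k (x - a) - arc_slope k 0) / 2 + (arc_slope k (b - x) - arc_slope k 0) / 2"
proof -
  have 1: "((\<lambda>y. kernel k (y - x)) has_integral (arc_slope k (x - a) - arc_slope k 0) / 2) {a..x}"
  proof -
    have "((\<lambda>y. sin (x - y) * weight k (x - y)) has_integral (- arc_slope k (x - x) / 2) - (- arc_slope k (x - a) / 2)) {a..x}"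
    proof (rule fundamental_theorem_of_calculus[OF assms(1)])
      fix y
      have "((\<lambda>y. - arc_slope k (x - y) / 2) has_real_derivative sin (x - y) * weight k (x - y)) (at y)"
        by (auto intro!: derivative_eq_intros DERIV_arc_slope[THEN DERIV_chain2])
      then show "((\<lambda>y. - arc_slope k (x - y) / 2) has_vector_derivative sin (x - y) * weight k (x - y)) (at y within {a..x})"
        unfolding has_real_derivative_iff_has_vector_derivative[symmetric] by (rule DERIV_subset) auto
    qed
    moreover have "sin (x - y) * weight k (x - y) = kernel k (y - x)" if "y \<in> {a..x}" for y
    proof -
      have "sin (x - y) \<ge> 0" using that assms by (intro sin_ge_zero) auto
      then show ?thesis using kernel_even[of k "x - y"] by (simp add: kernel_def)
    qed
    ultimately show ?thesis by (subst has_integral_cong) (auto simp: diff_divide_distrib)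
  qed
  have 2: "((\<lambda>y. kernel k (y - x)) has_integral (arc_slope k (b - x) - arc_slope k 0) / 2) {x..b}"
  proof -
    have "((\<lambda>y. sin (y - x) * weight k (y - x)) has_integral (arc_slope k (b - x) / 2) - (arc_slope k (x - x) / 2)) {x..b}"
    proof (rule fundamental_theorem_of_calculus[OF assms(2)])
      fix y
      have "((\<lambda>y. arc_slope k (y - x) / 2) has_real_derivative sin (y - x) * weight k (y - x)) (at y)"
        by (auto intro!: derivative_eq_intros DERIV_arc_slope[THEN DERIV_chain2])
      then show "((\<lambda>y. arc_slope k (y - x) / 2) has_vector_derivative sin (y - x) * weight k (y - x)) (at y within {x..b})"
        unfolding has_real_derivative_iff_has_vector_derivative[symmetric] by (rule DERIV_subset) auto
    qed
    moreover have "sin (y - x) * weight k (y - x) = kernel k (y - x)" if "y \<in> {x..b}" for y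
    proof -
      have "sin (y - x) \<ge> 0" using that assms by (intro sin_ge_zero) auto
      then show ?thesis by (simp add: kernel_def)
    qed
    ultimately show ?thesis by (subst has_integral_cong) (auto simp: diff_divide_distrib)
  qed
  have "set_integrable lborel {a..b} (\<lambda>y. kernel k (y - x))"
    by (intro borel_integrable_atLeastAtMost' continuous_intros)
  then show ?thesis
    using set_borel_integral_eq_integral(2) has_integral_combine[OF assms(1,2) 1 2]
    by (metis integral_unique)
qed

text \<open>Integrating a second time brings in \<open>arc_value k\<close>. The linear term compensates for the slope
  of \<open>arc_value k\<close> at \<open>0\<close>, which is \<open>-4\<close> for odd \<open>k\<close> and \<open>0\<close> for even \<open>k\<close>.\<close>

lemma integral_kernel_arc_arc:
  assumes k: "k \<ge> 2" and "a \<le> b" "b - a \<le> pi"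
  shows "(LINT x:{a..b}|lborel. LINT y:{a..b}|lborel. kernel k (y - x)) + arc_slope k 0 * (b - a) = arc_value k (b - a)"
proof -
  let ?h = "\<lambda>x. (arc_slope k (x - a) - arc_slope k 0) / 2 + (arc_slope k (b - x) - arc_slope k 0) / 2"
  let ?H = "\<lambda>x. (arc_value k (x - a) - arc_slope k 0 * (x - a)) / 2 - (arc_value k (b - x) - arc_slope k 0 * (b - x)) / 2"
  have "(LINT x:{a..b}|lborel. LINT y:{a..b}|lborel. kernel k (y - x)) = (LINT x:{a..b}|lborel. ?h x)"
    by (rule set_lebesgue_integral_cong) (use assms in \<open>auto intro!: integral_kernel_point_arc\<close>)
  also have "\<dots> = (\<integral>x. ?h x * indicator {a..b} x \<partial>lborel)"
    unfolding set_lebesgue_integral_def by (simp add: mult.commute)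
  also have "\<dots> = ?H b - ?H a"
  proof (rule integral_FTC_Icc_real[OF assms(2)])
    fix x
    show "(?H has_real_derivative ?h x) (at x)"
      by (auto intro!: derivative_eq_intros DERIV_arc_value[OF k, THEN DERIV_chain2] simp: field_simps)
    show "isCont ?h x"
      unfolding arc_slope_def by (intro continuous_intros) auto
  qed
  also have "\<dots> = arc_value k (b - a) - arc_slope k 0 * (b - a)"
    by (simp add: field_simps)
  finally show ?thesis by simp
qed

section \<open>The potential of a half circle\<close>

text \<open>It vanishes for even \<open>k\<close> and is a sign for odd \<open>k\<close>, so it treats both parities uniformly.\<close>

definition half_sine :: "nat \<Rightarrow> real" where "half_sine k = sin (real k * pi / 2)"

text \<open>The integral of the kernel, based at a direction, over the half circle centred at distance \<open>t\<close>
  from that direction is its potential there. Multiplied by \<open>4 * half_sine k\<close>, the defect is twice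
  this potential plus \<open>arc_slope k 0\<close>: see \<open>integral_kernel_half_circle\<close>.\<close>

definition defect :: "nat \<Rightarrow> real \<Rightarrow> real" where
  "defect k t = half_sine k - real k * cos (real k * t) * cos t - sin (real k * t) * sin t"

lemma half_sine_square: "2 * (half_sine k)\<^sup>2 = 1 - (-1) ^ k"
proof -
  have "cos (real k * pi) = 1 - 2 * (half_sine k)\<^sup>2"
    using cos_double_sin[of "real k * pi / 2"] by (simp add: half_sine_def)
  then show ?thesis by simp
qed

lemma half_sine_sign: "(-1) ^ k * half_sine k = - half_sine k"
proof -
  have "sin (real k * pi - real k * pi / 2) = - ((-1) ^ k * half_sine k)"
    unfolding sin_diff half_sine_def by simp
  moreover have "real k * pi - real k * pi / 2 = real k * pi / 2" by simp
  ultimately show ?thesis unfolding half_sine_def by simp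
qed

lemma integral_kernel_half_circle:
  assumes "\<bar>\<tau>\<bar> \<le> pi/2"
  shows "2 * (LINT t:{\<phi> + \<tau> - pi/2..\<phi> + \<tau> + pi/2}|lborel. kernel k (t - \<phi>)) + arc_slope k 0 = 4 * half_sine k * defect k \<tau>"
proof -
  have "(LINT t:{\<phi> + \<tau> - pi/2..\<phi> + \<tau> + pi/2}|lborel. kernel k (t - \<phi>)) = (arc_slope k (pi/2 - \<tau>) - arc_slope k 0) / 2 + (arc_slope k (pi/2 + \<tau>) - arc_slope k 0) / 2"
    using integral_kernel_point_arc[of "\<phi> + \<tau> - pi/2" \<phi> "\<phi> + \<tau> + pi/2" k] assms by (auto simp: abs_le_iff add.commute)
  then have 1: "2 * (LINT t:{\<phi> + \<tau> - pi/2..\<phi> + \<tau> + pi/2}|lborel. kernel k (t - \<phi>)) + arc_slope k 0 = arc_slope k (pi/2 - \<tau>) + arc_slope k (pi/2 + \<tau>) - arc_slope k 0"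
    by (simp add: field_simps)
  have two: "cos (p - q) + cos (p + q) = 2 * cos p * cos q" for p q :: real by (simp add: cos_add cos_diff)
  have s: "cos ((real k - 1) * (pi/2)) = half_sine k" "cos ((real k + 1) * (pi/2)) = - half_sine k"
  proof -
    have "(real k - 1) * (pi/2) = real k * pi / 2 - pi/2" "(real k + 1) * (pi/2) = real k * pi / 2 + pi/2"
      by (simp_all add: field_simps)
    then show "cos ((real k - 1) * (pi/2)) = half_sine k" "cos ((real k + 1) * (pi/2)) = - half_sine k"
      by (simp_all only: cos_diff cos_add) (simp_all add: half_sine_def)
  qed
  have "arc_slope k (pi/2 - \<tau>) + arc_slope k (pi/2 + \<tau>) = - 2 * (cos (pi/2 - \<tau>) + cos (pi/2 + \<tau>)) +
      (-1) ^ k * ((real k + 1) * (cos ((real k - 1) * (pi/2) - (real k - 1) * \<tau>) + cos ((real k - 1) * (pi/2) + (real k - 1) * \<tau>))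
       - (real k - 1) * (cos ((real k + 1) * (pi/2) - (real k + 1) * \<tau>) + cos ((real k + 1) * (pi/2) + (real k + 1) * \<tau>)))"
    unfolding arc_slope_def by (simp add: ring_distribs)
  also have "\<dots> = (-1) ^ k * half_sine k * 2 * ((real k + 1) * cos ((real k - 1) * \<tau>) + (real k - 1) * cos ((real k + 1) * \<tau>))"
    unfolding two s by (simp add: algebra_simps)
  also have "(real k + 1) * cos ((real k - 1) * \<tau>) + (real k - 1) * cos ((real k + 1) * \<tau>)
      = 2 * (real k * cos (real k * \<tau>) * cos \<tau> + sin (real k * \<tau>) * sin \<tau>)"
  proof -
    have "(real k - 1) * \<tau> = real k * \<tau> - \<tau>" "(real k + 1) * \<tau> = real k * \<tau> + \<tau>"
      by (simp_all add: algebra_simps)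
    then show ?thesis by (simp only: cos_diff cos_add) (simp add: algebra_simps)
  qed
  also have "arc_slope k 0 = - 4 * (half_sine k)\<^sup>2"
    using half_sine_square[of k] by (simp add: arc_slope_def algebra_simps)
  ultimately show ?thesis unfolding 1 half_sine_sign by (simp add: defect_def algebra_simps power2_eq_square)
qed

lemma defect_even: "defect k (- t) = defect k t"
  by (simp add: defect_def)

lemma defect_half_pi: "defect k (pi/2) = 0"
  by (simp add: defect_def half_sine_def)

lemma DERIV_defect: "(defect k has_real_derivative ((real k)\<^sup>2 - 1) * (sin (real k * t) * cos t)) (at t)"
  unfolding defect_def by (auto intro!: derivative_eq_intros simp: algebra_simps power2_eq_square)

text \<open>The defect vanishes at \<open>\<pi>/2\<close>, and its derivative is at most \<open>(k\<^sup>2 - 1) cos t\<close> in absolute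
  value. Hence \<open>(k\<^sup>2 - 1) (1 - sin t)\<close> plus or minus the defect decreases to \<open>0\<close> on
  \<open>[0, \<pi>/2]\<close>, where also \<open>1 - sin t \<le> cos\<^sup>2 t\<close>. With \<open>t = arctan z\<close> the bound becomes integrable in \<open>z\<close>.\<close>

lemma abs_defect_le:
  assumes k: "k \<ge> 1" and t: "\<bar>t\<bar> \<le> pi/2"
  shows "\<bar>defect k t\<bar> \<le> ((real k)\<^sup>2 - 1) * (cos t)\<^sup>2"
proof -
  have k1: "(real k)\<^sup>2 - 1 \<ge> 0" using one_le_power[of "real k" 2] k by simp
  have *: "\<bar>defect k t\<bar> \<le> ((real k)\<^sup>2 - 1) * (cos t)\<^sup>2" if t: "0 \<le> t" "t \<le> pi/2" for t
  proof -
    have "0 \<le> ((real k)\<^sup>2 - 1) * (1 - sin t) + e * defect k t" if e: "e = 1 \<or> e = -1" for e :: real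
    proof -
      let ?h = "\<lambda>t. ((real k)\<^sup>2 - 1) * (1 - sin t) + e * defect k t"
      have "?h (pi/2) \<le> ?h t"
      proof (rule DERIV_nonpos_imp_nonincreasing[OF t(2)])
        fix x assume x: "t \<le> x" "x \<le> pi/2"
        have "(?h has_real_derivative (((real k)\<^sup>2 - 1) * cos x) * (e * sin (real k * x) - 1)) (at x)"
          by (auto intro!: derivative_eq_intros DERIV_defect simp: algebra_simps)
        moreover have "(((real k)\<^sup>2 - 1) * cos x) * (e * sin (real k * x) - 1) \<le> 0"
          using x t k1 e cos_ge_zero[of x] sin_le_one[of "real k * x"] sin_ge_minus_one[of "real k * x"]
          by (intro mult_nonneg_nonpos) auto
        ultimately show "\<exists>y. (?h has_real_derivative y) (at x) \<and> y \<le> 0" by blast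
      qed
      then show ?thesis by (simp add: defect_half_pi)
    qed
    from this[of 1] this[of "-1"] have "\<bar>defect k t\<bar> \<le> ((real k)\<^sup>2 - 1) * (1 - sin t)" by (auto simp: abs_le_iff)
    also have "\<dots> \<le> ((real k)\<^sup>2 - 1) * (cos t)\<^sup>2"
    proof (rule mult_left_mono[OF _ k1])
      have "0 \<le> (1 - sin t) * sin t" using t by (intro mult_nonneg_nonneg sin_ge_zero) auto
      then have "(sin t)\<^sup>2 \<le> sin t" by (simp add: algebra_simps power2_eq_square)
      then show "1 - sin t \<le> (cos t)\<^sup>2" unfolding cos_squared_eq by simp
    qed
    finally show ?thesis .
  qed
  show ?thesis using *[of t] *[of "-t"] t by (cases "0 \<le> t") (auto simp: defect_even)
qed

lemma cos_arctan_square: "(cos (arctan z))\<^sup>2 = inverse (1 + z\<^sup>2)"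
  by (simp add: cos_arctan power_divide inverse_eq_divide add_nonneg_nonneg)

lemma isCont_defect: "isCont (defect k) t"
  using DERIV_defect by (rule DERIV_isCont)

lemma integrable_defect_arctan:
  assumes k: "k \<ge> 1"
  shows "integrable lborel (\<lambda>z. defect k (arctan z))"
proof (rule Bochner_Integration.integrable_bound)
  show "integrable lborel (\<lambda>z. ((real k)\<^sup>2 - 1) * inverse (1 + z\<^sup>2))"
    using integrable_inverse_1_plus_square by (simp add: set_integrable_def)
  show "AE z in lborel. norm (defect k (arctan z)) \<le> norm (((real k)\<^sup>2 - 1) * inverse (1 + z\<^sup>2))"
  proof (rule AE_I2)
    fix z :: real
    have "\<bar>arctan z\<bar> \<le> pi/2" using arctan_bounded[of z] by (auto simp: abs_le_iff)
    from abs_defect_le[OF k this]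
    show "norm (defect k (arctan z)) \<le> norm (((real k)\<^sup>2 - 1) * inverse (1 + z\<^sup>2))"
      unfolding cos_arctan_square real_norm_def by linarith
  qed
  show "(\<lambda>z. defect k (arctan z)) \<in> borel_measurable lborel"
    by (simp, intro borel_measurable_continuous_onI continuous_at_imp_continuous_on ballI
       isCont_o2[OF isCont_arctan isCont_defect])
qed

text \<open>Numerator and denominator vanish at \<open>\<pi>/2\<close> and \<open>-\<pi>/2\<close>, and so does the derivative of the numerator, since
  \<open>sin (k \<pi>/2) cos (k \<pi>/2) = 0\<close>; the derivative of the denominator does not.\<close>

lemma defect_primitive_tendsto:
  assumes t: "t = pi/2 \<or> t = - (pi/2)"
  shows "((\<lambda>x. half_sine k * (half_sine k * sin x - sin (real k * x)) / cos x) \<longlongrightarrow> 0) (at t)"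
proof -
  let ?N = "\<lambda>x. half_sine k * (half_sine k * sin x - sin (real k * x))"
  have "half_sine k * cos (real k * (pi / 2)) = sin (2 * (real k * pi / 2)) / 2"
    unfolding half_sine_def sin_double by simp
  then have z: "half_sine k = 0 \<or> cos (real k * pi / 2) = 0" by simp
  have ct: "cos t = 0" using t by (elim disjE) (simp_all only: cos_minus cos_pi_half)
  have st: "sin t \<noteq> 0" using ct sin_cos_squared_add[of t] by auto
  have cts: "cos (real k * t) = cos (real k * pi / 2)"
    using t by (elim disjE) (simp_all only: mult_minus_right cos_minus times_divide_eq_right)
  have Nt: "?N t = 0"
    using t by (elim disjE) (simp_all only: sin_minus sin_pi_half mult_minus_right, simp_all add: half_sine_def)
  have "(?N has_real_derivative half_sine k * (half_sine k * cos t - real k * cos (real k * t))) (at t)"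
    by (auto intro!: derivative_eq_intros)
  also have "half_sine k * (half_sine k * cos t - real k * cos (real k * t)) = 0"
    using z ct cts by auto
  finally have N: "((\<lambda>x. ?N x / (x - t)) \<longlongrightarrow> 0) (at t)"
    unfolding has_field_derivative_iff Nt by simp
  have "(cos has_real_derivative - sin t) (at t)" by (auto intro!: derivative_eq_intros)
  then have C: "((\<lambda>x. cos x / (x - t)) \<longlongrightarrow> - sin t) (at t)"
    unfolding has_field_derivative_iff ct by simp
  have "((\<lambda>x. (?N x / (x - t)) / (cos x / (x - t))) \<longlongrightarrow> 0 / (- sin t)) (at t)"
    by (intro tendsto_divide N C) (use st in auto)
  moreover have "\<forall>\<^sub>F x in at t. (?N x / (x - t)) / (cos x / (x - t)) = ?N x / cos x"
    using eventually_neq_at_within[of t t UNIV] by eventually_elim simp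
  ultimately show ?thesis using Lim_transform_eventually by fastforce
qed

text \<open>In the variable \<open>t = arctan z\<close> the integrand becomes the quotient of the defect by \<open>cos\<^sup>2 t\<close>,
  which has the primitive \<open>half_sine k * tan t - sin (k t) / cos t\<close>. After multiplication by
  \<open>half_sine k\<close> it tends to zero at both ends.\<close>

lemma integral_defect_arctan:
  assumes k: "k \<ge> 1"
  shows "(LINT z|lborel. half_sine k * defect k (arctan z)) = 0"
proof -
  let ?P = "\<lambda>x. half_sine k * (half_sine k * sin x - sin (real k * x)) / cos x"
  have "(LBINT z=-\<infinity>..\<infinity>. half_sine k * defect k (arctan z)) = 0 - 0"
  proof (rule interval_integral_FTC_integrable[where F = "\<lambda>z. ?P (arctan z)"])
    fix z :: real
    have c: "cos (arctan z) \<noteq> 0" by simp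
    have "(?P has_real_derivative half_sine k * defect k (arctan z) / (cos (arctan z))\<^sup>2) (at (arctan z))"
    proof -
      have "(?P has_real_derivative half_sine k * ((half_sine k * cos (arctan z) - real k * cos (real k * arctan z)) * cos (arctan z)
          + (half_sine k * sin (arctan z) - sin (real k * arctan z)) * sin (arctan z)) / (cos (arctan z))\<^sup>2) (at (arctan z))"
        using c by (auto intro!: derivative_eq_intros simp: power2_eq_square algebra_simps)
      also have "half_sine k * ((half_sine k * cos (arctan z) - real k * cos (real k * arctan z)) * cos (arctan z)
          + (half_sine k * sin (arctan z) - sin (real k * arctan z)) * sin (arctan z)) = half_sine k * defect k (arctan z)"
        unfolding defect_def using sin_cos_squared_add[of "arctan z"] by algebra
      finally show ?thesis .
    qed
    from DERIV_chain2[OF this DERIV_arctan]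
    have "((\<lambda>z. ?P (arctan z)) has_real_derivative half_sine k * defect k (arctan z)) (at z)"
      by (simp add: cos_arctan_square[symmetric] del: cos_arctan_not_zero) (use c in simp)
    then show "((\<lambda>z. ?P (arctan z)) has_vector_derivative half_sine k * defect k (arctan z)) (at z)"
      by (simp add: has_real_derivative_iff_has_vector_derivative)
    show "isCont (\<lambda>z. half_sine k * defect k (arctan z)) z"
      by (intro continuous_intros isCont_o2[OF isCont_arctan isCont_defect])
  next
    show "set_integrable lborel (einterval (-\<infinity>) \<infinity>) (\<lambda>z. half_sine k * defect k (arctan z))"
      using integrable_defect_arctan[OF k] by (simp add: set_integrable_def)
    have top: "filterlim arctan (at (pi/2)) at_top"
      using arctan_ubound by (intro filterlim_atI tendsto_arctan_at_top always_eventually) (auto simp: less_imp_neq)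
    have bot: "filterlim arctan (at (- (pi/2))) at_bot"
      using arctan_lbound by (intro filterlim_atI tendsto_arctan_at_bot always_eventually) (metis less_irrefl)
    show "(((\<lambda>z. ?P (arctan z)) \<circ> real_of_ereal) \<longlongrightarrow> 0) (at_right (-\<infinity>))"
      unfolding ereal_tendsto_simps by (rule filterlim_compose[OF defect_primitive_tendsto bot]) simp
    show "(((\<lambda>z. ?P (arctan z)) \<circ> real_of_ereal) \<longlongrightarrow> 0) (at_left \<infinity>)"
      unfolding ereal_tendsto_simps by (rule filterlim_compose[OF defect_primitive_tendsto top]) simp
  qed simp
  then show ?thesis by (simp add: interval_lebesgue_integral_def set_lebesgue_integral_def)
qed

section \<open>Energy of a set of directions\<close>

abbreviation full_turn :: "real set" where "full_turn \<equiv> {0..<2 * pi}"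

lemma abs_set_integral_le:
  fixes h :: "real \<Rightarrow> real"
  assumes "\<And>t. \<bar>h t\<bar> \<le> B" "a \<le> b"
  shows "\<bar>LINT t:{a..b}|lborel. h t\<bar> \<le> B * (b - a)"
proof -
  have B: "0 \<le> B" using assms(1)[of 0] by linarith
  have "\<bar>LINT t:{a..b}|lborel. h t\<bar> \<le> (\<integral>t. \<bar>indicator {a..b} t *\<^sub>R h t\<bar> \<partial>lborel)"
    unfolding set_lebesgue_integral_def by (rule integral_abs_bound)
  also have "\<dots> \<le> (\<integral>t. B * indicator {a..b} t \<partial>lborel)"
  proof (rule integral_mono')
    show "integrable lborel (\<lambda>t. B * indicator {a..b} t)"
      using assms(2) by (intro integrable_mult_right integrable_real_indicator) simp_all
  qed (use assms(1) B in \<open>auto simp: indicator_def\<close>)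
  also have "\<dots> = B * (b - a)" using assms(2) by simp
  finally show ?thesis .
qed

text \<open>The linear term puts the mass \<open>arc_slope k 0\<close> on the diagonal of the quadratic form; with it
  the energy of an arc is exactly \<open>arc_value k\<close> of its length.\<close>

definition energy :: "nat \<Rightarrow> (real \<Rightarrow> real) \<Rightarrow> real" where
  "energy k a = (LINT \<phi>:full_turn|lborel. a \<phi> * (LINT \<psi>:full_turn|lborel. a \<psi> * kernel k (\<psi> - \<phi>))) + arc_slope k 0 * (LINT \<phi>:full_turn|lborel. a \<phi>)"

lemma energy_arc:
  assumes k: "k \<ge> 2" and per: "\<And>t. A (t + 2 * pi) = A t" and [measurable]: "Measurable.pred borel A"
    and A: "\<And>t. t \<in> {c..<c + 2 * pi} \<Longrightarrow> A t \<longleftrightarrow> t \<in> {a<..<b}"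
    and ab: "c \<le> a" "a \<le> b" "b \<le> c + 2 * pi" "b - a \<le> pi"
  shows "energy k (\<lambda>t. of_bool (A t)) = arc_value k (b - a)"
proof -
  let ?h = "\<lambda>\<phi>. LINT \<psi>:{a..b}|lborel. kernel k (\<psi> - \<phi>)"
  have kper: "kernel k (t - 2 * pi) = kernel k t" for t using kernel_periodic[of k "t - 2 * pi"] by simp
  have inner: "(LINT \<psi>:full_turn|lborel. of_bool (A \<psi>) * kernel k (\<psi> - \<phi>)) = ?h \<phi>" for \<phi>
  proof (rule set_integral_arc[OF _ per _ _ _ A ab(1-3)])
    show "kernel k (t + 2 * pi - \<phi>) = kernel k (t - \<phi>)" for t
      using kernel_periodic[of k "t - \<phi>"] by (simp add: algebra_simps)
  qed (auto intro: abs_kernel_le)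
  have "(LINT \<phi>:full_turn|lborel. of_bool (A \<phi>) * ?h \<phi>) = (LINT \<phi>:{a..b}|lborel. ?h \<phi>)"
  proof (rule set_integral_arc[OF _ per _ _ _ A ab(1-3)])
    show "?h (\<phi> + 2 * pi) = ?h \<phi>" for \<phi>
      using kper[of "_ - \<phi>"] by (simp add: diff_diff_eq)
    show "\<bar>?h \<phi>\<bar> \<le> (2 + (real k)\<^sup>2) * (b - a)" for \<phi>
      by (intro abs_set_integral_le abs_kernel_le ab)
    show "?h \<in> borel_measurable borel"
      unfolding set_lebesgue_integral_def by measurable
  qed auto
  moreover have "(LINT \<phi>:full_turn|lborel. of_bool (A \<phi>) * (1::real)) = (LINT \<phi>:{a..b}|lborel. 1)"
    by (rule set_integral_arc[OF _ per _ _ _ A ab(1-3), where B = 1]) auto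
  moreover have "(LINT \<phi>:{a..b}|lborel. (1::real)) = b - a"
    using ab by (simp add: set_integral_const)
  ultimately show ?thesis
    unfolding energy_def inner using integral_kernel_arc_arc[OF k ab(2,4)] by simp
qed

lemma integrable_bounded_square:
  fixes h :: "real \<times> real \<Rightarrow> real"
  assumes [measurable]: "h \<in> borel_measurable borel" and b: "\<And>t. \<bar>h t\<bar> \<le> B"
  shows "integrable lborel (\<lambda>t. indicator (full_turn \<times> full_turn) t * h t)"
proof (rule Bochner_Integration.integrable_bound)
  have "emeasure lborel (full_turn \<times> full_turn) < \<infinity>"
    by (simp add: lborel_prod[symmetric] lborel.emeasure_pair_measure_Times ennreal_mult_less_top)
  then show "integrable lborel (\<lambda>t. B * indicator (full_turn \<times> full_turn) t)"
    by (intro integrable_mult_right integrable_real_indicator) (simp_all add: lborel_prod[symmetric])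
  show "AE t in lborel. norm (indicator (full_turn \<times> full_turn) t * h t) \<le> norm (B * indicator (full_turn \<times> full_turn) t)"
    using b by (intro AE_I2) (auto simp: indicator_def intro: order_trans[OF _ abs_ge_self])
  have [measurable]: "full_turn \<times> full_turn \<in> sets borel" by (auto simp: borel_prod[symmetric])
  show "(\<lambda>t. indicator (full_turn \<times> full_turn) t * h t) \<in> borel_measurable lborel" by simp
qed

lemma
  fixes h :: "real \<times> real \<Rightarrow> real"
  assumes [measurable]: "h \<in> borel_measurable borel" and b: "\<And>t. \<bar>h t\<bar> \<le> B"
  shows iterated_integral_square: "(LINT \<phi>:full_turn|lborel. LINT \<psi>:full_turn|lborel. h (\<phi>, \<psi>)) = (\<integral>t. indicator (full_turn \<times> full_turn) t * h t \<partial>lborel)"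
    and iterated_integral_square_swap: "(LINT \<phi>:full_turn|lborel. LINT \<psi>:full_turn|lborel. h (\<psi>, \<phi>)) = (\<integral>t. indicator (full_turn \<times> full_turn) t * h t \<partial>lborel)"
proof -
  have int: "integrable (lborel \<Otimes>\<^sub>M lborel) (\<lambda>t. indicator (full_turn \<times> full_turn) t * h t)"
    unfolding lborel_prod by (rule integrable_bounded_square[OF assms])
  show "(LINT \<phi>:full_turn|lborel. LINT \<psi>:full_turn|lborel. h (\<phi>, \<psi>)) = (\<integral>t. indicator (full_turn \<times> full_turn) t * h t \<partial>lborel)"
    using lborel_pair.integral_fst'[OF int]
    unfolding lborel_prod set_lebesgue_integral_def indicator_times by (simp add: mult.assoc)
  have eq: "(\<lambda>(x, y). indicator full_turn y * (indicator full_turn x * h (x, y))) = (\<lambda>t. indicator (full_turn \<times> full_turn) t * h t)"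
    by (auto simp: fun_eq_iff indicator_def)
  have "integrable (lborel \<Otimes>\<^sub>M lborel) (\<lambda>(x, y). indicator full_turn y * (indicator full_turn x * h (x, y)))"
    unfolding eq by (rule int)
  from lborel_pair.integral_snd[OF this]
  show "(LINT \<phi>:full_turn|lborel. LINT \<psi>:full_turn|lborel. h (\<psi>, \<phi>)) = (\<integral>t. indicator (full_turn \<times> full_turn) t * h t \<partial>lborel)"
    unfolding eq lborel_prod set_lebesgue_integral_def by simp
qed

text \<open>Bilinear expansion. The kernel is even, so by Fubini the two mixed terms agree.\<close>

lemma energy_diff:
  assumes [measurable]: "a \<in> borel_measurable borel" "e \<in> borel_measurable borel"
    and a: "\<And>t. \<bar>a t\<bar> \<le> 1" and e: "\<And>t. \<bar>e t\<bar> \<le> 1"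
  shows "energy k (\<lambda>t. a t - e t) = energy k a
      - (LINT \<phi>:full_turn|lborel. e \<phi> * (2 * (LINT \<psi>:full_turn|lborel. a \<psi> * kernel k (\<psi> - \<phi>)) + arc_slope k 0))
      + (LINT \<phi>:full_turn|lborel. LINT \<psi>:full_turn|lborel. e \<phi> * e \<psi> * kernel k (\<psi> - \<phi>))"
proof -
  define B where "B = 2 + (real k)\<^sup>2"
  have B: "B \<ge> 0" by (simp add: B_def)
  define conv where "conv = (\<lambda>h \<phi>. LINT \<psi>:full_turn|lborel. h \<psi> * kernel k (\<psi> - \<phi>))"
  have kernel_bound: "\<bar>h t * kernel k s\<bar> \<le> B" if "\<bar>h t\<bar> \<le> 1" for h :: "real \<Rightarrow> real" and t s
    using mult_mono[OF that abs_kernel_le[of k s]] by (simp add: abs_mult B_def)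
  have conv_int: "set_integrable lborel full_turn (\<lambda>\<psi>. h \<psi> * kernel k (\<psi> - \<phi>))"
    if [measurable]: "h \<in> borel_measurable borel" and "\<And>t. \<bar>h t\<bar> \<le> 1" for h \<phi>
    by (rule set_integrable_bounded_interval[where B = B]) (auto intro: kernel_bound that)
  have conv_diff: "conv (\<lambda>t. a t - e t) \<phi> = conv a \<phi> - conv e \<phi>" for \<phi>
    unfolding conv_def left_diff_distrib using a e by (intro set_integral_diff conv_int) auto
  have conv_meas [measurable]: "conv h \<in> borel_measurable borel" if [measurable]: "h \<in> borel_measurable borel" for h
    unfolding conv_def set_lebesgue_integral_def by measurable
  have conv_le: "\<bar>conv h \<phi>\<bar> \<le> B * (2 * pi)" if h: "\<And>t. \<bar>h t\<bar> \<le> 1" for h \<phi>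
  proof -
    have "\<bar>conv h \<phi>\<bar> \<le> (\<integral>\<psi>. \<bar>indicator full_turn \<psi> *\<^sub>R (h \<psi> * kernel k (\<psi> - \<phi>))\<bar> \<partial>lborel)"
      unfolding conv_def set_lebesgue_integral_def by (rule integral_abs_bound)
    also have "\<dots> \<le> (\<integral>\<psi>. B * indicator full_turn \<psi> \<partial>lborel)"
    proof (rule integral_mono')
      show "integrable lborel (\<lambda>t. B * indicator full_turn t)"
        by (intro integrable_mult_right integrable_real_indicator) simp_all
    qed (use kernel_bound[of h, OF h] B in \<open>auto simp: indicator_def\<close>)
    finally show ?thesis by simp
  qed
  have int: "set_integrable lborel full_turn (\<lambda>\<phi>. h \<phi> * conv g \<phi>)"
    if [measurable]: "h \<in> borel_measurable borel" "g \<in> borel_measurable borel"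
      and h: "\<And>t. \<bar>h t\<bar> \<le> 1" and g: "\<And>t. \<bar>g t\<bar> \<le> 1" for h g
  proof (rule set_integrable_bounded_interval[where B = "B * (2 * pi)"])
    show "\<bar>h t * conv g t\<bar> \<le> B * (2 * pi)" for t
      using mult_mono[OF h[of t] conv_le[of g t, OF g]] by (simp add: abs_mult)
  qed simp
  have int1: "set_integrable lborel full_turn h" if "h \<in> borel_measurable borel" "\<And>t. \<bar>h t\<bar> \<le> 1" for h :: "real \<Rightarrow> real"
    by (rule set_integrable_bounded_interval[OF that])
  have swap: "(LINT \<phi>:full_turn|lborel. a \<phi> * conv e \<phi>) = (LINT \<phi>:full_turn|lborel. e \<phi> * conv a \<phi>)"
  proof -
    let ?h = "\<lambda>t. a (fst t) * (e (snd t) * kernel k (snd t - fst t))"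
    have m: "?h \<in> borel_measurable borel" by (simp add: borel_prod[symmetric])
    have le: "\<bar>?h t\<bar> \<le> B" for t
      using mult_mono[OF a[of "fst t"] kernel_bound[of e "snd t", OF e]] B by (simp add: abs_mult)
    have "(LINT \<phi>:full_turn|lborel. a \<phi> * conv e \<phi>) = (LINT \<phi>:full_turn|lborel. LINT \<psi>:full_turn|lborel. ?h (\<phi>, \<psi>))"
      by (simp add: conv_def)
    also have "\<dots> = (LINT \<phi>:full_turn|lborel. LINT \<psi>:full_turn|lborel. ?h (\<psi>, \<phi>))"
      using iterated_integral_square[OF m le] iterated_integral_square_swap[OF m le] by simp
    also have "\<dots> = (LINT \<phi>:full_turn|lborel. e \<phi> * conv a \<phi>)"
    proof -
      have "?h (\<psi>, \<phi>) = e \<phi> * (a \<psi> * kernel k (\<psi> - \<phi>))" for \<phi> \<psi>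
        using kernel_even[of k "\<phi> - \<psi>"] by simp
      then show ?thesis by (simp only: conv_def set_integral_mult_right)
    qed
    finally show ?thesis .
  qed
  note i = int[OF assms(1) assms(1) a a] int[OF assms(1) assms(2) a e] int[OF assms(2) assms(1) e a] int[OF assms(2) assms(2) e e]
    int1[OF assms(1) a] int1[OF assms(2) e]
  have "(LINT \<phi>:full_turn|lborel. (a \<phi> - e \<phi>) * (conv a \<phi> - conv e \<phi>))
     = (LINT \<phi>:full_turn|lborel. (a \<phi> * conv a \<phi> - a \<phi> * conv e \<phi>) - (e \<phi> * conv a \<phi> - e \<phi> * conv e \<phi>))"
    by (simp add: algebra_simps)
  also have "\<dots> = ((LINT \<phi>:full_turn|lborel. a \<phi> * conv a \<phi>) - (LINT \<phi>:full_turn|lborel. a \<phi> * conv e \<phi>))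
       - ((LINT \<phi>:full_turn|lborel. e \<phi> * conv a \<phi>) - (LINT \<phi>:full_turn|lborel. e \<phi> * conv e \<phi>))"
    by (simp only: set_integral_diff(2)[OF set_integral_diff(1)[OF i(1,2)] set_integral_diff(1)[OF i(3,4)]]
        set_integral_diff(2)[OF i(1,2)] set_integral_diff(2)[OF i(3,4)])
  finally have 1: "(LINT \<phi>:full_turn|lborel. (a \<phi> - e \<phi>) * (conv a \<phi> - conv e \<phi>)) = (LINT \<phi>:full_turn|lborel. a \<phi> * conv a \<phi>)
     - 2 * (LINT \<phi>:full_turn|lborel. e \<phi> * conv a \<phi>) + (LINT \<phi>:full_turn|lborel. e \<phi> * conv e \<phi>)"
    using swap by simp
  have 2: "(LINT \<phi>:full_turn|lborel. a \<phi> - e \<phi>) = (LINT \<phi>:full_turn|lborel. a \<phi>) - (LINT \<phi>:full_turn|lborel. e \<phi>)"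
    using i by (intro set_integral_diff)
  have "(LINT \<phi>:full_turn|lborel. e \<phi> * (2 * conv a \<phi> + arc_slope k 0)) = (LINT \<phi>:full_turn|lborel. 2 * (e \<phi> * conv a \<phi>) + arc_slope k 0 * e \<phi>)"
    by (simp add: algebra_simps)
  also have "\<dots> = 2 * (LINT \<phi>:full_turn|lborel. e \<phi> * conv a \<phi>) + arc_slope k 0 * (LINT \<phi>:full_turn|lborel. e \<phi>)"
    using i by (subst set_integral_add(2)) auto
  finally have 3: "(LINT \<phi>:full_turn|lborel. e \<phi> * (2 * conv a \<phi> + arc_slope k 0)) = 2 * (LINT \<phi>:full_turn|lborel. e \<phi> * conv a \<phi>) + arc_slope k 0 * (LINT \<phi>:full_turn|lborel. e \<phi>)" .
  have 4: "(LINT \<phi>:full_turn|lborel. LINT \<psi>:full_turn|lborel. e \<phi> * e \<psi> * kernel k (\<psi> - \<phi>)) = (LINT \<phi>:full_turn|lborel. e \<phi> * conv e \<phi>)"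
    unfolding conv_def by (simp only: mult.assoc set_integral_mult_right)
  have en: "energy k h = (LINT \<phi>:full_turn|lborel. h \<phi> * conv h \<phi>) + arc_slope k 0 * (LINT \<phi>:full_turn|lborel. h \<phi>)" for h
    unfolding energy_def conv_def ..
  have R: "(LINT \<phi>:full_turn|lborel. e \<phi> * (2 * (LINT \<psi>:full_turn|lborel. a \<psi> * kernel k (\<psi> - \<phi>)) + arc_slope k 0))
      = (LINT \<phi>:full_turn|lborel. e \<phi> * (2 * conv a \<phi> + arc_slope k 0))"
    unfolding conv_def ..
  show ?thesis
    unfolding en R conv_diff 1 2 3 4 by (simp add: algebra_simps)
qed

section \<open>Lines meeting a convex body\<close>

text \<open>The lines meeting \<open>K\<close>, described by the values of linear functionals on \<open>K\<close> and with unrestricted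
  angle \<open>\<phi>\<close>.\<close>

definition hitting_lines :: "(real^2) set \<Rightarrow> (real \<times> real) set" where
  "hitting_lines K = {(p, \<phi>). 0 < p \<and> (\<exists>x\<in>K. p \<le> x \<bullet> dir \<phi>)}"

text \<open>If \<open>x \<in> K\<close> lies on the line or beyond it, the segment from the origin to \<open>x\<close> crosses the line
  inside \<open>K\<close>.\<close>

lemma lines_meeting_eq:
  assumes "convex K" "0 \<in> K"
  shows "lines_meeting K = hitting_lines K \<inter> UNIV \<times> full_turn"
proof -
  have line: "X \<in> polar_line (p, \<phi>) \<longleftrightarrow> X \<bullet> dir \<phi> = p" if "p > 0" for p \<phi> X
    using that by (auto simp: polar_line_def polar_point_dir inner_diff_left)
  have "polar_line (p, \<phi>) \<inter> K \<noteq> {} \<longleftrightarrow> (\<exists>x\<in>K. p \<le> x \<bullet> dir \<phi>)" if p: "p > 0" for p \<phi>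
  proof
    assume "polar_line (p, \<phi>) \<inter> K \<noteq> {}"
    then show "\<exists>x\<in>K. p \<le> x \<bullet> dir \<phi>" using line[OF p] by force
  next
    assume "\<exists>x\<in>K. p \<le> x \<bullet> dir \<phi>"
    then obtain x where x: "x \<in> K" "p \<le> x \<bullet> dir \<phi>" by blast
    have "(p / (x \<bullet> dir \<phi>)) *\<^sub>R x + (1 - p / (x \<bullet> dir \<phi>)) *\<^sub>R 0 \<in> K"
      using x p assms by (intro convexD) (auto simp: field_simps)
    moreover have "(p / (x \<bullet> dir \<phi>)) *\<^sub>R x \<in> polar_line (p, \<phi>)"
      using line[OF p] x p by auto
    ultimately show "polar_line (p, \<phi>) \<inter> K \<noteq> {}" by auto
  qed
  then show ?thesis by (auto simp: lines_meeting_def line_coords_def hitting_lines_def)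
qed

text \<open>Weakening the inequality to \<open>p - 1 / (n + 1) < x \<bullet> dir \<phi>\<close> gives open sets, and by compactness
  of \<open>K\<close> their intersection over all \<open>n\<close> adds no further lines.\<close>

lemma hitting_lines_borel:
  assumes "compact K"
  shows "hitting_lines K \<in> sets borel"
proof -
  let ?U = "\<lambda>n::nat. \<Union>x\<in>K. {z::real \<times> real. fst z - 1 / (real n + 1) < x \<bullet> dir (snd z)}"
  have "hitting_lines K = {z. 0 < fst z} \<inter> (\<Inter>n. ?U n)"
  proof (intro set_eqI iffI)
    fix z assume "z \<in> hitting_lines K"
    then obtain x where x: "0 < fst z" "x \<in> K" "fst z \<le> x \<bullet> dir (snd z)" by (auto simp: hitting_lines_def split_beta')
    have "fst z - 1 / (real n + 1) < x \<bullet> dir (snd z)" for n :: nat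
      using x(3) by (smt (verit) divide_pos_pos of_nat_0_le_iff)
    then show "z \<in> {z. 0 < fst z} \<inter> (\<Inter>n. ?U n)" using x by blast
  next
    fix z assume z: "z \<in> {z. 0 < fst z} \<inter> (\<Inter>n. ?U n)"
    then have ne: "K \<noteq> {}" by blast
    have "continuous_on K (\<lambda>x. x \<bullet> dir (snd z))" by (intro continuous_intros)
    then obtain y where y: "y \<in> K" "\<And>x. x \<in> K \<Longrightarrow> x \<bullet> dir (snd z) \<le> y \<bullet> dir (snd z)"
      using continuous_attains_sup[OF assms ne] by blast
    have "fst z \<le> y \<bullet> dir (snd z)"
    proof (rule ccontr)
      assume "\<not> ?thesis"
      then obtain n where "inverse (real (Suc n)) < fst z - y \<bullet> dir (snd z)"
        using reals_Archimedean[of "fst z - y \<bullet> dir (snd z)"] by auto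
      moreover obtain x where "x \<in> K" "fst z - 1 / (real n + 1) < x \<bullet> dir (snd z)" using z by blast
      ultimately show False using y(2)[of x] by (simp add: inverse_eq_divide add.commute)
    qed
    then show "z \<in> hitting_lines K" using z y by (auto simp: hitting_lines_def split_beta')
  qed
  moreover have "open (?U n)" for n
    by (intro open_UN ballI open_Collect_less continuous_intros)
  moreover have "open {z::real \<times> real. 0 < fst z}"
    by (intro open_Collect_less continuous_intros)
  ultimately show ?thesis by auto
qed

lemma hitting_lines_le:
  assumes "compact K"
  obtains B where "\<And>p \<phi>. (p, \<phi>) \<in> hitting_lines K \<Longrightarrow> 0 < p \<and> p \<le> B"
proof -
  obtain B where B: "\<And>x. x \<in> K \<Longrightarrow> norm x \<le> B"
    using compact_imp_bounded[OF assms] by (auto simp: bounded_iff)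
  have "0 < p \<and> p \<le> B" if "(p, \<phi>) \<in> hitting_lines K" for p \<phi>
  proof -
    obtain x where x: "x \<in> K" "p \<le> x \<bullet> dir \<phi>" "0 < p" using \<open>(p, \<phi>) \<in> hitting_lines K\<close> by (auto simp: hitting_lines_def)
    have "x \<bullet> dir \<phi> \<le> norm x * norm (dir \<phi>)" by (rule norm_cauchy_schwarz)
    then show ?thesis using x B[OF x(1)] by simp
  qed
  then show ?thesis by (rule that)
qed

lemma integrable_lines_meeting:
  fixes h :: "real \<times> real \<Rightarrow> real"
  assumes K: "compact K" and [measurable]: "h \<in> borel_measurable borel"
    and h: "\<And>z. z \<in> hitting_lines K \<Longrightarrow> \<bar>h z\<bar> \<le> C"
  shows "integrable lborel (\<lambda>z. indicator (hitting_lines K \<inter> UNIV \<times> full_turn) z * h z)"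
proof -
  obtain B where B: "\<And>p \<phi>. (p, \<phi>) \<in> hitting_lines K \<Longrightarrow> 0 < p \<and> p \<le> B" using hitting_lines_le[OF K] by blast
  have m[measurable]: "hitting_lines K \<inter> UNIV \<times> full_turn \<in> sets borel"
    using hitting_lines_borel[OF K] by (intro sets.Int) (auto simp: borel_prod[symmetric])
  have sub: "hitting_lines K \<inter> UNIV \<times> full_turn \<subseteq> {0..max 0 B} \<times> full_turn" using B by fastforce
  have "emeasure lborel ({0..max 0 B} \<times> full_turn) < \<infinity>"
    by (simp add: lborel_prod[symmetric] lborel.emeasure_pair_measure_Times ennreal_mult_less_top)
  moreover have "emeasure lborel (hitting_lines K \<inter> UNIV \<times> full_turn) \<le> emeasure lborel ({0..max 0 B} \<times> full_turn)"
    by (rule emeasure_mono[OF sub]) (simp add: lborel_prod[symmetric])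
  ultimately have fin: "emeasure lborel (hitting_lines K \<inter> UNIV \<times> full_turn) < \<infinity>" by (rule order_le_less_trans[rotated])
  show ?thesis
  proof (rule Bochner_Integration.integrable_bound)
    show "integrable lborel (\<lambda>z. C * indicator (hitting_lines K \<inter> UNIV \<times> full_turn) z)"
      using fin m by (intro integrable_mult_right integrable_real_indicator) simp_all
    show "AE z in lborel. norm (indicator (hitting_lines K \<inter> UNIV \<times> full_turn) z * h z) \<le> norm (C * indicator (hitting_lines K \<inter> UNIV \<times> full_turn) z)"
      using h by (intro AE_I2) (auto simp: indicator_def intro: order_trans[OF _ abs_ge_self])
  qed simp
qed

section \<open>The angle function at a single point\<close>

text \<open>The indicator of the set of normal angles of lines through \<open>P\<close> that meet \<open>K\<close>
  and have a positive \<open>p\<close> at that angle.\<close>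

definition hit :: "(real^2) set \<Rightarrow> real^2 \<Rightarrow> real \<Rightarrow> real" where
  "hit K P \<phi> = indicator (hitting_lines K) (P \<bullet> dir \<phi>, \<phi>)"

lemma measurable_hit [measurable]:
  assumes "compact K"
  shows "hit K P \<in> borel_measurable borel"
proof -
  have [measurable]: "hitting_lines K \<in> sets (borel \<Otimes>\<^sub>M borel)" using hitting_lines_borel[OF assms] unfolding borel_prod .
  show ?thesis unfolding hit_def by measurable
qed

lemma cos_positive_arc:
  assumes "t \<in> {c - pi/2..<c - pi/2 + 2 * pi}"
  shows "cos (t - c) > 0 \<longleftrightarrow> t \<in> {c - pi/2<..<c + pi/2}"
  using cos_negative_arc[of 0 "t - c + pi"] assms by auto

text \<open>For \<open>P \<noteq> 0\<close> the half circle has energy \<open>arc_value k pi = 0\<close>; for \<open>P = 0\<close> the set is empty.\<close>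

lemma energy_half_circle:
  assumes "k \<ge> 2"
  shows "energy k (\<lambda>t. of_bool (P \<bullet> dir t > 0)) = 0"
proof -
  obtain r \<theta> where r: "0 \<le> r" "P = r *\<^sub>R dir \<theta>" using dir_polar by blast
  show ?thesis
  proof (cases "r = 0")
    case True
    then show ?thesis by (simp add: r energy_def)
  next
    case False
    then have "P \<bullet> dir t > 0 \<longleftrightarrow> cos (t - \<theta>) > 0" for t using r by (simp add: zero_less_mult_iff)
    then have eq: "(\<lambda>t. of_bool (P \<bullet> dir t > 0)) = (\<lambda>t. of_bool (cos (t - \<theta>) > 0) :: real)" by simp
    have "energy k (\<lambda>t. of_bool (cos (t - \<theta>) > 0)) = arc_value k ((\<theta> + pi/2) - (\<theta> - pi/2))"
    proof (rule energy_arc[OF assms, where c = "\<theta> - pi/2"])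
      show "(0 < cos (t + 2 * pi - \<theta>)) = (0 < cos (t - \<theta>))" for t
        using cos_periodic[of "t - \<theta>"] by (simp add: algebra_simps)
      show "(0 < cos (t - \<theta>)) = (t \<in> {\<theta> - pi/2<..<\<theta> + pi/2})"
        if "t \<in> {\<theta> - pi/2..<\<theta> - pi/2 + 2 * pi}" for t
        by (rule cos_positive_arc[OF that])
    qed simp_all
    then show ?thesis unfolding eq by simp
  qed
qed

text \<open>Since \<open>0 \<in> K\<close>, a direction that separates \<open>P\<close> from \<open>K\<close> is positive on \<open>P\<close>. Removing the hitting
  directions from the half circle of \<open>P\<close> therefore leaves exactly the separating ones.\<close>

lemma energy_separating:
  fixes K :: "(real^2) set"
  assumes K: "compact K" "convex K" "0 \<in> K" "C2_closed_curve (frontier K)" and k: "k \<ge> 2"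
  shows "energy k (\<lambda>t. of_bool (P \<bullet> dir t > 0) - hit K P t) = (if P \<in> K then 0 else f k (visual_angle K P))"
proof -
  have sep: "of_bool (P \<bullet> dir t > 0) - hit K P t = of_bool (\<forall>x\<in>K. x \<bullet> dir t < P \<bullet> dir t)" for t
  proof -
    have "P \<bullet> dir t > 0" if "\<forall>x\<in>K. x \<bullet> dir t < P \<bullet> dir t" using that K(3) by force
    then show ?thesis by (auto simp: hit_def hitting_lines_def indicator_def not_less)
  qed
  show ?thesis
  proof (cases "P \<in> K")
    case True
    then have "of_bool (P \<bullet> dir t > 0) - hit K P t = (0::real)" for t unfolding sep by auto
    then show ?thesis using True by (simp add: energy_def)
  next
    case False
    have ne: "K \<noteq> {}" using K by auto
    obtain u v c where uvc: "\<And>n. (\<forall>x\<in>K. x \<bullet> n < P \<bullet> n) \<longleftrightarrow> u \<bullet> n < 0 \<and> v \<bullet> n < 0"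
      "0 \<le> visual_angle K P" "visual_angle K P \<le> pi"
      "\<And>t. t \<in> {c..<c + 2 * pi} \<Longrightarrow> (u \<bullet> dir t < 0 \<and> v \<bullet> dir t < 0) \<longleftrightarrow> t \<in> {c + visual_angle K P<..<c + pi}"
      using visual_angle_arc[OF K(1,2) ne K(4) False] by blast
    have "energy k (\<lambda>t. of_bool (u \<bullet> dir t < 0 \<and> v \<bullet> dir t < 0)) = arc_value k ((c + pi) - (c + visual_angle K P))"
    proof (rule energy_arc[OF k, where c = c])
      show "(u \<bullet> dir t < 0 \<and> v \<bullet> dir t < 0) = (t \<in> {c + visual_angle K P<..<c + pi})"
        if "t \<in> {c..<c + 2 * pi}" for t
        by (rule uvc(4)[OF that])
    qed (use uvc(2,3) in simp_all)
    then show ?thesis using False unfolding sep uvc(1) by (simp add: f_eq_arc_value)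
  qed
qed

text \<open>The defect seen from a point with coordinates \<open>x\<close> along the normal of a line and \<open>y\<close> along the
  line.\<close>

definition plane_defect :: "nat \<Rightarrow> real \<Rightarrow> real \<Rightarrow> real" where
  "plane_defect k x y = 4 * (half_sine k * defect k (arctan (y / x)))"

text \<open>The half circle of \<open>P\<close> is centred at the direction of \<open>P\<close>, which deviates from \<open>\<phi>\<close> by the
  arctangent of the quotient of the two coordinates of \<open>P\<close>.\<close>

lemma half_circle_rotated:
  assumes x: "P \<bullet> dir \<phi> > 0"
  shows "2 * (LINT \<psi>:full_turn|lborel. of_bool (P \<bullet> dir \<psi> > 0) * kernel k (\<psi> - \<phi>)) + arc_slope k 0
     = plane_defect k (P \<bullet> dir \<phi>) (P \<bullet> dir (\<phi> + pi/2))"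
proof -
  define x y \<tau> where "x = P \<bullet> dir \<phi>" and "y = P \<bullet> dir (\<phi> + pi/2)" and "\<tau> = arctan (y / x)"
  have x: "x > 0" using assms by (simp add: x_def)
  have c: "cos \<tau> > 0" unfolding \<tau>_def using arctan_bounded by (intro cos_gt_zero_pi) auto
  have "tan \<tau> = y / x" by (simp add: \<tau>_def tan_arctan)
  then have y: "x * sin \<tau> = y * cos \<tau>" using c x by (simp add: tan_def field_simps)
  have A: "P \<bullet> dir \<psi> > 0 \<longleftrightarrow> cos (\<psi> - (\<phi> + \<tau>)) > 0" for \<psi>
  proof -
    have "cos \<tau> * (P \<bullet> dir \<psi>) = cos \<tau> * (x * cos (\<psi> - \<phi>)) + (y * cos \<tau>) * sin (\<psi> - \<phi>)"
      by (simp add: inner_dir_rotate[of P \<psi> \<phi>] x_def y_def algebra_simps)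
    also have "\<dots> = x * cos (\<psi> - \<phi> - \<tau>)"
      unfolding y[symmetric] cos_diff[of "\<psi> - \<phi>"] by (simp add: algebra_simps)
    finally have "cos \<tau> * (P \<bullet> dir \<psi>) > 0 \<longleftrightarrow> x * cos (\<psi> - \<phi> - \<tau>) > 0" by simp
    then show ?thesis using c x by (simp add: zero_less_mult_iff diff_diff_eq)
  qed
  have "(LINT \<psi>:full_turn|lborel. of_bool (P \<bullet> dir \<psi> > 0) * kernel k (\<psi> - \<phi>)) = (LINT \<psi>:{\<phi> + \<tau> - pi/2..\<phi> + \<tau> + pi/2}|lborel. kernel k (\<psi> - \<phi>))"
    unfolding A
  proof (rule set_integral_arc[where c = "\<phi> + \<tau> - pi/2"])
    show "kernel k (t + 2 * pi - \<phi>) = kernel k (t - \<phi>)" for t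
      using kernel_periodic[of k "t - \<phi>"] by (simp add: algebra_simps)
    show "(0 < cos (t + 2 * pi - (\<phi> + \<tau>))) = (0 < cos (t - (\<phi> + \<tau>)))" for t
      using cos_periodic[of "t - (\<phi> + \<tau>)"] by (simp add: algebra_simps)
    show "\<bar>kernel k (t - \<phi>)\<bar> \<le> 2 + (real k)\<^sup>2" for t by (rule abs_kernel_le)
    show "(0 < cos (t - (\<phi> + \<tau>))) = (t \<in> {\<phi> + \<tau> - pi/2<..<\<phi> + \<tau> + pi/2})"
      if "t \<in> {\<phi> + \<tau> - pi/2..<\<phi> + \<tau> - pi/2 + 2 * pi}" for t
      by (rule cos_positive_arc[OF that])
  qed simp_all
  moreover have "\<bar>\<tau>\<bar> \<le> pi/2" using arctan_bounded[of "y / x"] by (auto simp: \<tau>_def abs_le_iff)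
  ultimately show ?thesis
    using integral_kernel_half_circle[of \<tau> \<phi> k] by (simp add: plane_defect_def \<tau>_def x_def y_def)
qed

text \<open>The two parts of the bilinear expansion that depend on the lines hitting \<open>K\<close>: one is linear
  and the other quadratic in \<open>hit K P\<close>.\<close>

definition linear_term :: "(real^2) set \<Rightarrow> nat \<Rightarrow> real^2 \<Rightarrow> real" where
  "linear_term K k P = (LINT \<phi>:full_turn|lborel. hit K P \<phi> * plane_defect k (P \<bullet> dir \<phi>) (P \<bullet> dir (\<phi> + pi/2)))"

definition hit_energy :: "(real^2) set \<Rightarrow> nat \<Rightarrow> real^2 \<Rightarrow> real" where
  "hit_energy K k P = (LINT \<phi>:full_turn|lborel. LINT \<psi>:full_turn|lborel. hit K P \<phi> * hit K P \<psi> * kernel k (\<psi> - \<phi>))"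

lemma visual_angle_pointwise:
  fixes K :: "(real^2) set"
  assumes K: "compact K" "convex K" "0 \<in> K" "C2_closed_curve (frontier K)" and k: "k \<ge> 2"
  shows "indicator (- K) P * f k (visual_angle K P) = hit_energy K k P - linear_term K k P"
proof -
  have [measurable]: "hit K P \<in> borel_measurable borel" by (rule measurable_hit[OF K(1)])
  let ?a = "\<lambda>t. of_bool (P \<bullet> dir t > 0) :: real"
  have "energy k (\<lambda>t. ?a t - hit K P t) = energy k ?a
      - (LINT \<phi>:full_turn|lborel. hit K P \<phi> * (2 * (LINT \<psi>:full_turn|lborel. ?a \<psi> * kernel k (\<psi> - \<phi>)) + arc_slope k 0)) + hit_energy K k P"
    unfolding hit_energy_def
  proof (rule energy_diff)
    show "\<bar>hit K P t\<bar> \<le> 1" for t by (simp add: hit_def indicator_def)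
  qed simp_all
  moreover have "(LINT \<phi>:full_turn|lborel. hit K P \<phi> * (2 * (LINT \<psi>:full_turn|lborel. ?a \<psi> * kernel k (\<psi> - \<phi>)) + arc_slope k 0)) = linear_term K k P"
    unfolding linear_term_def
  proof (intro set_lebesgue_integral_cong allI impI)
    fix \<phi>
    show "hit K P \<phi> * (2 * (LINT \<psi>:full_turn|lborel. ?a \<psi> * kernel k (\<psi> - \<phi>)) + arc_slope k 0)
      = hit K P \<phi> * plane_defect k (P \<bullet> dir \<phi>) (P \<bullet> dir (\<phi> + pi/2))"
    proof (cases "P \<bullet> dir \<phi> > 0")
      case True
      then show ?thesis by (simp only: half_circle_rotated)
    qed (simp add: hit_def hitting_lines_def)
  qed simp
  ultimately show ?thesis
    using energy_half_circle[OF k, of P] energy_separating[OF K k, of P] by (auto simp: indicator_def)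
qed

section \<open>Integration over the plane\<close>

text \<open>The factor \<open>\<bar>sin\<bar>\<close> of the kernel is the density of pairs of lines with respect to their meeting
  point and angles; what remains of the kernel is the weight, which is bounded on a set of pairs of
  finite measure.\<close>

lemma
  fixes K :: "(real^2) set" and k :: nat
  assumes K: "compact K" "convex K" "0 \<in> K"
  defines "W \<equiv> \<lambda>z::(real \<times> real) \<times> (real \<times> real). weight k (snd (snd z) - snd (fst z))"
  shows integrable_hit_energy: "integrable lborel (hit_energy K k)"
    and integrable_line_pairs: "set_integrable lborel (lines_meeting K \<times> lines_meeting K) W"
    and integral_hit_energy: "integral\<^sup>L lborel (hit_energy K k) = set_lebesgue_integral lborel (lines_meeting K \<times> lines_meeting K) W"
proof -
  define L where "L = hitting_lines K \<inter> UNIV \<times> full_turn"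
  have L: "lines_meeting K = L" unfolding L_def by (rule lines_meeting_eq[OF K(2,3)])
  have [measurable]: "L \<in> sets borel"
    unfolding L_def using hitting_lines_borel[OF K(1)] by (intro sets.Int) (auto simp: borel_prod[symmetric])
  have [measurable]: "L \<in> sets (borel \<Otimes>\<^sub>M borel)" unfolding borel_prod by simp
  let ?g = "\<lambda>z::(real^2) \<times> real \<times> real. ((fst z \<bullet> dir (fst (snd z)), fst (snd z)), (fst z \<bullet> dir (snd (snd z)), snd (snd z)))"
  let ?w = "\<lambda>z::(real^2) \<times> real \<times> real. \<bar>sin (snd (snd z) - fst (snd z))\<bar>"
  let ?H = "\<lambda>z. indicator (L \<times> L) z * W z"
  have mW[measurable]: "W \<in> borel_measurable borel"
    unfolding W_def weight_def borel_prod[symmetric] by measurable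
  have mLL[measurable]: "L \<times> L \<in> sets borel"
    unfolding borel_prod[symmetric, where 'a = "real \<times> real" and 'b = "real \<times> real"] by measurable
  have mH[measurable]: "?H \<in> borel_measurable borel" by measurable
  have mg[measurable]: "?g \<in> borel_measurable borel" unfolding borel_prod[symmetric] by measurable
  have mw[measurable]: "?w \<in> borel_measurable borel" unfolding borel_prod[symmetric] by measurable
  have intL: "integrable lborel (indicator L :: _ \<Rightarrow> real)"
    using integrable_lines_meeting[OF K(1), of "\<lambda>_. 1" 1] by (simp add: L_def)
  have finL: "emeasure lborel L < \<infinity>" using intL by (simp add: integrable_indicator_iff)
  have "emeasure lborel (L \<times> L) < \<infinity>"
    using finL by (simp add: lborel_prod[symmetric, where 'a = "real \<times> real" and 'b = "real \<times> real"] lborel.emeasure_pair_measure_Times ennreal_mult_less_top)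
  then have intLL: "integrable lborel (\<lambda>z. (2 + (real k)\<^sup>2) * indicator (L \<times> L) z)"
    by (intro integrable_mult_right integrable_real_indicator) simp_all
  have intH: "integrable lborel ?H"
  proof (rule Bochner_Integration.integrable_bound[OF intLL])
    show "AE z in lborel. norm (?H z) \<le> norm ((2 + (real k)\<^sup>2) * indicator (L \<times> L) z)"
      using abs_weight_le by (intro AE_I2) (auto simp: indicator_def W_def intro: order_trans[OF _ abs_ge_self])
  qed simp
  then show "set_integrable lborel (lines_meeting K \<times> lines_meeting K) W"
    unfolding set_integrable_def L by simp
  note D = distr_density_line_pairs
  have wH: "?w z * ?H (?g z) = indicator (full_turn \<times> full_turn) (snd z) * (hit K (fst z) (fst (snd z)) * hit K (fst z) (snd (snd z)) * kernel k (snd (snd z) - fst (snd z)))" for z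
    by (auto simp: indicator_def L_def hit_def W_def kernel_def mem_Times_iff)
  have "integrable (distr (density lborel (\<lambda>z. ennreal (?w z))) borel ?g) ?H" unfolding D by (rule intH)
  then have int1: "integrable lborel (\<lambda>z. ?w z * ?H (?g z))"
    by (subst (asm) integrable_distr_eq) (simp_all add: integrable_real_density)
  have "integral\<^sup>L lborel ?H = integral\<^sup>L (distr (density lborel (\<lambda>z. ennreal (?w z))) borel ?g) ?H" unfolding D ..
  also have "\<dots> = (\<integral>z. ?w z * ?H (?g z) \<partial>lborel)"
    by (subst integral_distr) (simp_all add: integral_real_density)
  finally have eq1: "integral\<^sup>L lborel ?H = (\<integral>z. ?w z * ?H (?g z) \<partial>lborel)" .
  have inner: "(\<integral>t. ?w (P, t) * ?H (?g (P, t)) \<partial>lborel) = hit_energy K k P" for P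
  proof -
    have [measurable]: "hit K P \<in> borel_measurable borel" by (rule measurable_hit[OF K(1)])
    let ?h = "\<lambda>t. hit K P (fst t) * hit K P (snd t) * kernel k (snd t - fst t)"
    have m: "?h \<in> borel_measurable borel" by (simp add: borel_prod[symmetric])
    have le: "\<bar>?h t\<bar> \<le> 2 + (real k)\<^sup>2" for t
      using abs_kernel_le[of k "snd t - fst t"] by (auto simp: hit_def indicator_def)
    show ?thesis unfolding wH hit_energy_def using iterated_integral_square[OF m le] by simp
  qed
  have int2: "integrable (lborel \<Otimes>\<^sub>M lborel) (\<lambda>z. ?w z * ?H (?g z))" unfolding lborel_prod by (rule int1)
  show "integrable lborel (hit_energy K k)"
    using lborel_pair.integrable_fst'[OF int2] unfolding inner .
  have "integral\<^sup>L lborel (hit_energy K k) = integral\<^sup>L lborel ?H"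
    using lborel_pair.integral_fst'[OF int2] unfolding inner eq1 lborel_prod .
  then show "integral\<^sup>L lborel (hit_energy K k) = set_lebesgue_integral lborel (lines_meeting K \<times> lines_meeting K) W"
    unfolding set_lebesgue_integral_def L by simp
qed

text \<open>The function is homogeneous of degree zero in \<open>(x, y)\<close>, so scaling \<open>y\<close> by \<open>x\<close> reduces
  everything to \<open>x = 1\<close>.\<close>

lemma
  assumes k: "k \<ge> 1" and x: "x > 0"
  shows integrable_plane_defect: "integrable lborel (plane_defect k x)"
    and integral_plane_defect: "integral\<^sup>L lborel (plane_defect k x) = 0"
    and integral_norm_plane_defect: "(LINT y|lborel. norm (plane_defect k x y)) = x * (LINT z|lborel. norm (plane_defect k 1 z))"
proof -
  have nz: "x \<noteq> 0" using x by simp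
  have scale: "plane_defect k x (0 + x * z) = plane_defect k 1 z" for z
    using x by (simp add: plane_defect_def)
  have int1: "integrable lborel (plane_defect k 1)"
    using integrable_defect_arctan[OF k] unfolding plane_defect_def by simp
  have "integrable lborel (\<lambda>z. plane_defect k x (0 + x * z))"
    unfolding scale by (rule int1)
  then show "integrable lborel (plane_defect k x)"
    using x by (subst (asm) lborel_integrable_real_affine_iff) auto
  have "integral\<^sup>L lborel (plane_defect k x) = \<bar>x\<bar> *\<^sub>R (LINT z|lborel. plane_defect k 1 z)"
    using lborel_integral_real_affine[OF nz, of "plane_defect k x" 0] unfolding scale .
  also have "(LINT z|lborel. plane_defect k 1 z) = 0"
    unfolding plane_defect_def using integral_defect_arctan[OF k] by simp
  finally show "integral\<^sup>L lborel (plane_defect k x) = 0" by simp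
  show "(LINT y|lborel. norm (plane_defect k x y)) = x * (LINT z|lborel. norm (plane_defect k 1 z))"
    using lborel_integral_real_affine[OF nz, of "\<lambda>y. norm (plane_defect k x y)" 0] x unfolding scale by simp
qed

text \<open>In rotated coordinates the integral over the position \<open>y\<close> of \<open>P\<close> on its line vanishes for each
  line. Exchanging the integrals is legitimate because the norm integrates over \<open>y\<close> to a multiple
  of \<open>x\<close>, and \<open>x\<close> is bounded on the lines meeting \<open>K\<close>.\<close>

lemma
  fixes K :: "(real^2) set"
  assumes K: "compact K" and k: "k \<ge> 1"
  shows integrable_linear_term: "integrable lborel (linear_term K k)"
    and integral_linear_term: "integral\<^sup>L lborel (linear_term K k) = 0"
proof -
  define L where "L = hitting_lines K \<inter> UNIV \<times> full_turn"
  have mL[measurable]: "L \<in> sets borel"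
    unfolding L_def using hitting_lines_borel[OF K] by (intro sets.Int) (auto simp: borel_prod[symmetric])
  have mL'[measurable]: "L \<in> sets (borel \<Otimes>\<^sub>M borel)" unfolding borel_prod by simp
  let ?H = "\<lambda>z::(real \<times> real) \<times> real. indicator L (fst z) * plane_defect k (fst (fst z)) (snd z)"
  let ?g = "\<lambda>z::(real^2) \<times> real. ((fst z \<bullet> dir (snd z), snd z), fst z \<bullet> dir (snd z + pi/2))"
  let ?C = "LINT z|lborel. norm (plane_defect k 1 z)"
  have [measurable]: "defect k \<in> borel_measurable borel"
    by (intro borel_measurable_continuous_onI continuous_at_imp_continuous_on ballI isCont_defect)
  have mH: "?H \<in> borel_measurable (borel \<Otimes>\<^sub>M borel)"
    unfolding plane_defect_def borel_prod[symmetric, where 'a = real and 'b = real] by measurable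
  then have mH': "?H \<in> borel_measurable borel" unfolding borel_prod .
  have mg: "?g \<in> borel_measurable borel" unfolding borel_prod[symmetric] by measurable
  have pos: "fst z > 0" if "z \<in> L" for z using that by (auto simp: L_def hitting_lines_def)
  obtain B where B: "\<And>p \<phi>. (p, \<phi>) \<in> hitting_lines K \<Longrightarrow> 0 < p \<and> p \<le> B" using hitting_lines_le[OF K] by blast
  have int: "integrable (lborel \<Otimes>\<^sub>M lborel) ?H"
  proof (rule lborel_pair.Fubini_integrable)
    have "(LINT y|lborel. norm (?H (z, y))) = indicator L z * (fst z * ?C)" for z
      using integral_norm_plane_defect[OF k pos] by (cases "z \<in> L") (auto simp: indicator_def)
    moreover have "integrable lborel (\<lambda>z. indicator L z * (fst z * ?C))"
      unfolding L_def
    proof (rule integrable_lines_meeting[OF K, where C = "B * ?C"])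
      fix z assume "z \<in> hitting_lines K"
      then have "0 < fst z" "fst z \<le> B" using B[of "fst z" "snd z"] by auto
      moreover have "?C \<ge> 0" by simp
      ultimately show "\<bar>fst z * ?C\<bar> \<le> B * ?C" by (simp add: abs_mult mult_right_mono)
    qed (simp add: borel_prod[symmetric])
    ultimately show "integrable lborel (\<lambda>z. LINT y|lborel. norm (?H (z, y)))" by simp
    show "AE z in lborel. integrable lborel (\<lambda>y. ?H (z, y))"
      using integrable_plane_defect[OF k pos] by (intro AE_I2) (auto simp: indicator_def)
  qed (use mH in simp)
  have inner0: "(LINT y|lborel. ?H (z, y)) = 0" for z
    using integral_plane_defect[OF k pos] by (cases "z \<in> L") (auto simp: indicator_def)
  have int0: "integral\<^sup>L lborel ?H = 0"
    using lborel_pair.integral_fst'[OF int] unfolding inner0 lborel_prod by simp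
  have intH: "integrable lborel ?H" using int unfolding lborel_prod .
  have int1: "integrable lborel (\<lambda>z. ?H (?g z))"
    using intH unfolding distr_rotated_coordinates[symmetric]
    by (subst (asm) integrable_distr_eq) (use mg mH' in simp_all)
  have eq1: "(LINT z|lborel. ?H (?g z)) = 0"
    using int0 unfolding distr_rotated_coordinates[symmetric]
    by (subst (asm) integral_distr) (use mg mH' in simp_all)
  have inner: "(LINT \<phi>|lborel. ?H (?g (P, \<phi>))) = linear_term K k P" for P
    unfolding linear_term_def set_lebesgue_integral_def
    by (rule Bochner_Integration.integral_cong) (auto simp: L_def hit_def indicator_def)
  have int2: "integrable (lborel \<Otimes>\<^sub>M lborel) (\<lambda>z. ?H (?g z))" unfolding lborel_prod by (rule int1)
  show "integrable lborel (linear_term K k)"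
    using lborel_pair.integrable_fst'[OF int2] unfolding inner .
  show "integral\<^sup>L lborel (linear_term K k) = 0"
    using lborel_pair.integral_fst'[OF int2] unfolding inner lborel_prod eq1 .
qed

theorem proposition2:
  fixes K :: "(real^2) set" and k :: nat
  assumes "compact K" and "convex K" and "C2_closed_curve (frontier K)"
    and "0 \<in> interior K" and "k \<ge> 2"
  shows "set_integrable lborel (- K) (\<lambda>P. f k (visual_angle K P)) \<and>
    set_integrable lborel (lines_meeting K \<times> lines_meeting K)
      (\<lambda>((p1, \<phi>1), (p2, \<phi>2)). 1 + (-1) ^ k * ((real k)\<^sup>2 - 1) * cos (real k * (\<phi>2 - \<phi>1))) \<and>
    set_lebesgue_integral lborel (- K) (\<lambda>P. f k (visual_angle K P)) =
    set_lebesgue_integral lborel (lines_meeting K \<times> lines_meeting K)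
      (\<lambda>((p1, \<phi>1), (p2, \<phi>2)). 1 + (-1) ^ k * ((real k)\<^sup>2 - 1) * cos (real k * (\<phi>2 - \<phi>1)))"
proof -
  have K0: "0 \<in> K" using assms(4) interior_subset by blast
  have k1: "k \<ge> 1" using assms(5) by simp
  have W: "(\<lambda>((p1, \<phi>1), (p2, \<phi>2)). 1 + (-1) ^ k * ((real k)\<^sup>2 - 1) * cos (real k * (\<phi>2 - \<phi>1)))
     = (\<lambda>z::(real \<times> real) \<times> (real \<times> real). weight k (snd (snd z) - snd (fst z)))"
    by (auto simp: fun_eq_iff weight_def)
  have pw: "(\<lambda>P. indicator (- K) P *\<^sub>R f k (visual_angle K P)) = (\<lambda>P. hit_energy K k P - linear_term K k P)"
    using visual_angle_pointwise[OF assms(1,2) K0 assms(3,5)] by (auto simp: fun_eq_iff)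
  note I1 = integrable_hit_energy[OF assms(1,2) K0, of k] and I2 = integrable_linear_term[OF assms(1) k1]
  show ?thesis
    unfolding W set_integrable_def[of lborel "- K"] set_lebesgue_integral_def[of lborel "- K"] pw
    using I1 I2 integrable_line_pairs[OF assms(1,2) K0, of k] integral_hit_energy[OF assms(1,2) K0, of k]
      integral_linear_term[OF assms(1) k1] by simp
qed

end
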